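(* Let $\mathbb{T}$ be a time scale, $a,b\in\mathbb{T}$ with $a<b$, and let $f:[a,b]\to\mathbb{R}$ be twice delta-differentiable with $M=\sup_{a<t<b}|f^{\Delta\Delta}(t)|<\infty$. Then for all $x\in[a,b]$, $$\begin{aligned} &\left|f(x)-\frac{\int_a^bf^{\Delta}(\sigma(s))\Delta s}{(b-a)^2}\Big[h_2(x,a)-h_2(x,b)\Big]-\frac{1}{b-a}\int_a^bf(\sigma(t))\Delta t\right|\\ &\qquad\le\frac{M}{(b-a)^2}\int_a^b|K(t,x)|\Big[h_2(t,a)+h_2(t,b)\Big]\Delta t, \end{aligned}$$ where $$K(t,x)=\begin{cases}t-a, & t\in[a,x),\\ t-b, & t\in[x,b].\end{cases}$$
   Context: A time scale $\mathbb{T}$ is a nonempty closed subset of $\mathbb{R}$ with the subspace topology; $[a,b]$ denotes $\{t\in\mathbb{T}: a\le t\le b\}$ (similarly for half-open and open intervals). The forward and backward jump operators are $\sigma(t)=\inf\{s\in\mathbb{T}:s>t\}$ and $\rho(t)=\sup\{s\in\mathbb{T}:s<t\}$; $t$ is right-scattered if $\sigma(t)>t$ and left-scattered if $\rho(t)<t$. $\mathbb{T}^{\kappa}=\mathbb{T}\setminus\{m\}$ if $\mathbb{T}$ has a left-scattered maximum $m$, and $\mathbb{T}^\kappa=\mathbb{T}$ otherwise. The delta derivative $f^{\Delta}(t)$ of $f:\mathbb{T}\to\mathbb{R}$ at $t\in\mathbb{T}^{\kappa}$ is the number (if it exists) such that for every $\epsilon>0$ there is a neighborhood $U$ of $t$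 with $|f(\sigma(t))-f(s)-f^{\Delta}(t)(\sigma(t)-s)|\le\epsilon|\sigma(t)-s|$ for all $s\in U$; $f^{\Delta\Delta}=(f^\Delta)^\Delta$. If $F^{\Delta}=f$ then $\int_a^bf(s)\Delta s:=F(b)-F(a)$; for integrands with no such antiderivative (e.g. functions with a jump at $x$) the integral is the usual Lebesgue $\Delta$-integral on $[a,b)$, which extends this definition for continuous integrands. The functions $h_k$ are defined by $h_0(t,s)=1$ and $h_{k+1}(t,s)=\int_s^th_k(\tau,s)\Delta\tau$ for $s,t\in\mathbb{T}$ (with $\int_s^t=-\int_t^s$). It is understood that $f^\Delta$ exists at all points of $[a,b]$, including $b$ (if $b$ is right-scattered, $f^\Delta(b)$ uses the value $f(\sigma(b))$).
   Formalization: The inequality with M as the supremum over a<t<b is proved except when x=a and a is right-scattered, where it is false (T=Z, a=0, b=2, f(0)=0, f(n)=n-1 for n>=1); for all x in [a,b] it is also proved with the supremum over a<=t<b. *)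

theory Defs
  imports "HOL-Analysis.Analysis"
begin

definition time_scale :: "real set \<Rightarrow> bool" where
  "time_scale T \<longleftrightarrow> closed T \<and> T \<noteq> {}"

text \<open>The usual conventions \<open>inf \<emptyset> = sup T\<close> and \<open>sup \<emptyset> = inf T\<close> make the
  jump operators fix a maximum, respectively a minimum, of \<open>T\<close>.\<close>

definition forward_jump :: "real set \<Rightarrow> real \<Rightarrow> real" where
  "forward_jump T t = (if \<exists>s\<in>T. t < s then Inf {s\<in>T. t < s} else t)"

definition backward_jump :: "real set \<Rightarrow> real \<Rightarrow> real" where
  "backward_jump T t = (if \<exists>s\<in>T. s < t then Sup {s\<in>T. s < t} else t)"

definition ts_kappa :: "real set \<Rightarrow> real set" where
  "ts_kappa T = T - {m\<in>T. (\<forall>s\<in>T. s \<le> m) \<and> backward_jump T m < m}"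

definition has_delta_derivative ::
    "real set \<Rightarrow> (real \<Rightarrow> real) \<Rightarrow> real \<Rightarrow> real \<Rightarrow> bool" where
  "has_delta_derivative T f d t \<longleftrightarrow> t \<in> ts_kappa T \<and>
     (\<forall>\<epsilon>>0. \<exists>U. open U \<and> t \<in> U \<and>
        (\<forall>s\<in>U \<inter> T. \<bar>f (forward_jump T t) - f s - d * (forward_jump T t - s)\<bar>
                     \<le> \<epsilon> * \<bar>forward_jump T t - s\<bar>))"

definition delta_differentiable :: "real set \<Rightarrow> (real \<Rightarrow> real) \<Rightarrow> real \<Rightarrow> bool" where
  "delta_differentiable T f t \<longleftrightarrow> (\<exists>d. has_delta_derivative T f d t)"

definition delta_deriv :: "real set \<Rightarrow> (real \<Rightarrow> real) \<Rightarrow> real \<Rightarrow> real" where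
  "delta_deriv T f t = (THE d. has_delta_derivative T f d t)"

text \<open>The Lebesgue delta-measure is the extension to a measure on \<open>T\<close> of the length
  \<open>[s,t) \<mapsto> t - s\<close> of half-open time scale intervals. If \<open>T\<close> has a maximum, then the mass of
  that single point is left undetermined; it lies in no half-open interval, so it plays no role
  in the integrals below.\<close>

definition delta_measure :: "real set \<Rightarrow> real measure" where
  "delta_measure T = extend_measure T {(s, t). s \<in> T \<and> t \<in> T \<and> s \<le> t}
     (\<lambda>(s, t). T \<inter> {s..<t}) (\<lambda>(s, t). ennreal (t - s))"

definition delta_integral :: "real set \<Rightarrow> real \<Rightarrow> real \<Rightarrow> (real \<Rightarrow> real) \<Rightarrow> real" where
  "delta_integral T u v f =
     (if u \<le> v then (LINT t : T \<inter> {u..<v} | delta_measure T. f t)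
      else - (LINT t : T \<inter> {v..<u} | delta_measure T. f t))"

fun delta_h :: "real set \<Rightarrow> nat \<Rightarrow> real \<Rightarrow> real \<Rightarrow> real" where
  "delta_h T 0 t s = 1"
| "delta_h T (Suc k) t s = delta_integral T s t (\<lambda>\<tau>. delta_h T k \<tau> s)"

definition montgomery_kernel :: "real \<Rightarrow> real \<Rightarrow> real \<Rightarrow> real \<Rightarrow> real" where
  "montgomery_kernel a b t x = (if t < x then t - a else t - b)"

text \<open>The extension required in the definition of \<open>delta_measure\<close> exists: push Lebesgue measure
  forward along \<open>u \<mapsto> sup {s \<in> T. s \<le> u}\<close>.\<close>

lemma emeasure_delta_measure_interval:
  assumes T: "time_scale T" and "s \<in> T" "t \<in> T" "s \<le> t"
  shows "emeasure (delta_measure T) (T \<inter> {s..<t}) = ennreal (t - s)"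
proof -
  define G where "G = (\<lambda>(s, t). T \<inter> {s..<t}) ` {(s, t). s \<in> T \<and> t \<in> T \<and> s \<le> t}"
  define U where "U = {u. \<exists>s\<in>T. s \<le> u}"
  define p where "p = (\<lambda>u. Sup {s\<in>T. s \<le> u})"
  have cl: "closed T" using T by (simp add: time_scale_def)
  have GT: "G \<subseteq> Pow T" by (auto simp: G_def)
  have pT: "p u \<in> T \<and> p u \<le> u" if "u \<in> U" for u
  proof -
    have eq: "{s\<in>T. s \<le> u} = T \<inter> {..u}" by auto
    have "Sup (T \<inter> {..u}) \<in> T \<inter> {..u}"
      by (rule closed_contains_Sup) (use that cl in \<open>auto simp: U_def intro: closed_Int\<close>)
    then show ?thesis by (simp add: p_def eq)
  qed
  have p_ge: "s' \<le> p u \<longleftrightarrow> s' \<le> u" if "u \<in> U" "s' \<in> T" for u s'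
  proof
    assume "s' \<le> p u" then show "s' \<le> u" using pT[OF that(1)] by linarith
  next
    assume "s' \<le> u" then show "s' \<le> p u"
      unfolding p_def using that by (intro cSup_upper) (auto intro!: bdd_aboveI[of _ u])
  qed
  have pre: "p -` (T \<inter> {s'..<t'}) \<inter> U = {s'..<t'}" if "s' \<in> T" "t' \<in> T" for s' t'
  proof -
    have "u \<in> U" if "s' \<le> u" for u using that \<open>s' \<in> T\<close> by (auto simp: U_def)
    then show ?thesis
      using pT p_ge[OF _ \<open>s' \<in> T\<close>] p_ge[OF _ \<open>t' \<in> T\<close>] by (auto simp: not_le[symmetric])
  qed
  have Ub: "U \<in> sets borel"
  proof (cases "bdd_below T")
    case True
    have "Inf T \<in> T"
      using T True by (intro closed_contains_Inf) (auto simp: time_scale_def)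
    then have "U = {Inf T..}"
      using cInf_lower[OF _ True] by (fastforce simp: U_def)
    then show ?thesis by simp
  next
    case False
    then have "U = UNIV"
      by (auto simp: U_def bdd_below_def) (meson linear)
    then show ?thesis by simp
  qed
  define R where "R = restrict_space lborel U"
  have spR: "space R = U" by (simp add: R_def space_restrict_space)
  have meas: "p \<in> R \<rightarrow>\<^sub>M sigma T G"
  proof (rule measurable_measure_of[OF GT])
    show "p \<in> space R \<rightarrow> T" using pT spR by auto
  next
    fix A assume "A \<in> G"
    then obtain s' t' where A: "A = T \<inter> {s'..<t'}" "s' \<in> T" "t' \<in> T" by (auto simp: G_def)
    have "{s'..<t'} \<subseteq> U" using A by (auto simp: U_def)
    moreover have "p -` A \<inter> space R = {s'..<t'}"
      unfolding spR A(1) by (rule pre[OF A(2,3)])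
    ultimately show "p -` A \<inter> space R \<in> sets R"
      using Ub by (simp add: R_def sets_restrict_space_iff)
  qed
  define N where "N = distr R (sigma T G) p"
  have N: "emeasure N (T \<inter> {s'..<t'}) = ennreal (t' - s')"
    if "s' \<in> T" "t' \<in> T" "s' \<le> t'" for s' t'
  proof -
    have "T \<inter> {s'..<t'} \<in> sets (sigma T G)"
      using that GT by (intro in_measure_of) (auto simp: G_def)
    then have "emeasure N (T \<inter> {s'..<t'}) = emeasure R {s'..<t'}"
      unfolding N_def using meas pre that by (simp add: emeasure_distr spR)
    also have "\<dots> = emeasure lborel {s'..<t'}"
      unfolding R_def using Ub that
      by (intro emeasure_restrict_space) (auto simp: U_def)
    finally show ?thesis using that by simp
  qed
  have setsD: "sets (delta_measure T) = sets N"
    unfolding delta_measure_def N_def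
    by (subst sets_extend_measure) (use GT in \<open>auto simp: G_def\<close>)
  show ?thesis
    using emeasure_extend_measure_Pair[of "delta_measure T" T
        "\<lambda>s t. s \<in> T \<and> t \<in> T \<and> s \<le> t" "\<lambda>s t. T \<inter> {s..<t}" "\<lambda>s t. ennreal (t - s)"
        "emeasure N" s t]
    using N setsD assms emeasure_countably_additive[of N] emeasure_positive[of N]
    by (auto simp: delta_measure_def)
qed

end

theory Submission
  imports Defs
begin

text \<open>The delta integral over \<open>[a,b)\<close> is the Lebesgue integral over \<open>[a,b]\<close> of the integrand
  composed with \<open>u \<mapsto> max {s \<in> T. s \<le> u}\<close>. Interpolating an antiderivative linearly across the
  gaps of \<open>T\<close> gives a continuous function that is differentiable off the countable set of gap end
  points, so the fundamental theorem of calculus for the Henstock-Kurzweil integral (with a countable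
  exceptional set) applies and no integrability of the second derivative need be assumed. Applied
  to \<open>(t - a) f t\<close> on \<open>[a,x]\<close> and to \<open>(t - b) f t\<close> on \<open>[x,b]\<close> it yields the Montgomery identity
  \<open>(b - a) f x = \<integral> f (\<sigma> t) + \<integral> K t x * f\<^sup>\<Delta> t\<close>. Substituting into it the same identity for \<open>f\<^sup>\<Delta> t\<close>
  leaves the double integral of \<open>K t x * K s t * f\<^sup>\<Delta>\<^sup>\<Delta> s\<close>, and \<open>\<integral> \<bar>K s t\<bar> \<Delta>s = h\<^sub>2 t a + h\<^sub>2 t b\<close>.
  The factor \<open>K t x * K s t\<close> vanishes at \<open>s = a\<close> unless \<open>t = x = a\<close>, which is why \<open>f\<^sup>\<Delta>\<^sup>\<Delta> a\<close> matters
  only if \<open>x = a\<close> is right-scattered.\<close>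

subsection \<open>The fundamental theorem of calculus with a countable exceptional set\<close>

text \<open>A gauge may choose its radius separately at each tag: differentiability supplies the
  radius at ordinary tags, continuity alone at exceptional ones. The Riemann sums are then compared
  with \<open>f b - f a\<close> directly.\<close>

theorem fundamental_theorem_of_calculus_countable:
  fixes f :: "real \<Rightarrow> 'a::banach"
  assumes "countable E" and ab: "a \<le> b"
    and D: "\<And>x. x \<in> {a<..<b} - E \<Longrightarrow> (f has_vector_derivative f' x) (at x)"
    and cont: "continuous_on {a..b} f"
  shows "(f' has_integral (f b - f a)) {a..b}"
proof -
  \<comment> \<open>The end points join the exceptional set because derivatives are given only in
    the open interval. They also make it nonempty, hence the range of a sequence.\<close>
  define E' where "E' = insert a (insert b E)"
  have "countable E'" "E' \<noteq> {}" using assms(1) by (auto simp: E'_def)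
  then obtain c :: "nat \<Rightarrow> real" where c: "E' = range c"
    by (metis range_from_nat_into)
  \<comment> \<open>\<open>H\<close> is increasing and jumps by at least \<open>2^(-n)\<close> across the exceptional point \<open>c n\<close>, so that
    the local errors are dominated by increments of \<open>H\<close>, which telescope.\<close>
  define h where "h n u = (1/2::real)^n * (of_bool (c n < u) + of_bool (c n \<le> u))" for n u
  define H where "H u = (\<Sum>n. h n u) + u" for u
  have hsum: "summable (\<lambda>n. h n u)" for u
  proof (rule summable_comparison_test')
    show "summable (\<lambda>n. (1/2::real)^n * 2)" by (intro summable_mult2 summable_geometric) simp
    show "norm (h n u) \<le> (1/2)^n * 2" for n by (auto simp: h_def)
  qed
  have hmono: "h n u \<le> h n v" if "u \<le> v" for n u v
    using that by (auto simp: h_def)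
  have Hdiff: "H v - H u = (\<Sum>n. h n v - h n u) + (v - u)" for u v
    by (simp add: H_def suminf_diff[OF hsum hsum])
  \<comment> \<open>The summand \<open>u\<close> of \<open>H\<close> pays for the errors at tags
    where \<open>f\<close> is differentiable.\<close>
  have H_ge: "v - u \<le> H v - H u" if "u \<le> v" for u v
    unfolding Hdiff using hmono[OF that] by (simp add: suminf_nonneg summable_diff hsum)
  \<comment> \<open>The two indicators make \<open>h n\<close> rise once on reaching
    \<open>c n\<close> and once on leaving it, so an interval with \<open>c n\<close> as an end
    point still collects \<open>(1/2)^n\<close>.\<close>
  have H_jump: "(1/2)^n \<le> H v - H u" if "u < v" "u \<le> c n" "c n \<le> v" for u v n
  proof -
    have "(1/2)^n \<le> h n v - h n u" using that by (auto simp: h_def)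
    also have "\<dots> \<le> (\<Sum>n. h n v - h n u)"
      using sum_le_suminf[of "\<lambda>n. h n v - h n u" "{n}"] hmono[of u v] that
      by (simp add: summable_diff hsum)
    finally show ?thesis using that by (simp add: Hdiff)
  qed
  have local_bound: "\<exists>d>0. \<forall>u v. u \<le> x \<longrightarrow> x \<le> v \<longrightarrow> {u..v} \<subseteq> ball x d \<inter> {a..b} \<longrightarrow>
      norm ((v - u) *\<^sub>R f' x - (f v - f u)) \<le> e * (H v - H u)"
    if x: "x \<in> {a..b}" and e: "e > 0" for x e
  proof (cases "x \<in> E'")
    case True
    then obtain n where n: "x = c n" using c by auto
    \<comment> \<open>The error splits into four terms, an increment of \<open>f\<close> and a
      multiple of \<open>f' x\<close> on either side of \<open>x\<close>; each receives a quarter of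
      the guaranteed \<open>e * (1/2)^n\<close>.\<close>
    define e' where "e' = e * (1/2)^n / 4"
    have e': "e' > 0" using e by (simp add: e'_def)
    obtain d where d: "d > 0" "\<And>w. w \<in> {a..b} \<Longrightarrow> \<bar>w - x\<bar> < d \<Longrightarrow> norm (f w - f x) < e'"
      using cont x e' unfolding continuous_on_iff by (force simp: dist_norm)
    define r where "r = min d (e' / (norm (f' x) + 1))"
    have r: "r > 0" using d e' by (auto simp: r_def intro!: divide_pos_pos add_nonneg_pos)
    have "norm ((v - u) *\<^sub>R f' x - (f v - f u)) \<le> e * (H v - H u)"
      if uv: "u \<le> x" "x \<le> v" "{u..v} \<subseteq> ball x r \<inter> {a..b}" for u v
    proof (cases "u = v")
      case False
      have *: "norm (f w - f x) \<le> e'" "\<bar>w - x\<bar> * norm (f' x) \<le> e'" if "w = u \<or> w = v" for w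
      proof -
        have "w \<in> {u..v}" using that uv by auto
        then have "w \<in> ball x r \<inter> {a..b}" using uv(3) by blast
        then have w: "w \<in> {a..b}" "\<bar>w - x\<bar> < r" by (auto simp: dist_real_def)
        then show "norm (f w - f x) \<le> e'" using d(2)[of w] by (auto simp: r_def)
        have "\<bar>w - x\<bar> * norm (f' x) \<le> e' / (norm (f' x) + 1) * (norm (f' x) + 1)"
          using w e' by (intro mult_mono) (auto simp: r_def)
        also have "\<dots> = e'" by (simp add: add_nonneg_eq_0_iff)
        finally show "\<bar>w - x\<bar> * norm (f' x) \<le> e'" .
      qed
      have "(v - u) *\<^sub>R f' x - (f v - f u)
          = ((v - x) *\<^sub>R f' x - (u - x) *\<^sub>R f' x) - ((f v - f x) - (f u - f x))"
        by (simp add: algebra_simps)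
      also have "norm \<dots> \<le> (norm ((v - x) *\<^sub>R f' x) + norm ((u - x) *\<^sub>R f' x))
          + (norm (f v - f x) + norm (f u - f x))"
        by (meson add_mono norm_triangle_ineq4 order_trans)
      also have "\<dots> \<le> (e' + e') + (e' + e')"
        using *[of u] *[of v] by (intro add_mono) auto
      also have "\<dots> = e * (1/2)^n" by (simp add: e'_def)
      also have "\<dots> \<le> e * (H v - H u)"
        using H_jump[of u v n] uv False e n by (intro mult_left_mono) auto
      finally show ?thesis .
    qed auto
    then show ?thesis using r by blast
  next
    case False
    then have "x \<in> {a<..<b} - E" using x by (auto simp: E'_def)
    from D[OF this] obtain d where d: "d > 0"
      "\<And>y. norm (y - x) < d \<Longrightarrow> norm (f y - f x - (y - x) *\<^sub>R f' x) \<le> e * norm (y - x)"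
      unfolding has_vector_derivative_def has_derivative_at_alt using e by blast
    have "norm ((v - u) *\<^sub>R f' x - (f v - f u)) \<le> e * (H v - H u)"
      if uv: "u \<le> x" "x \<le> v" "{u..v} \<subseteq> ball x d \<inter> {a..b}" for u v
    proof -
      have "u \<in> {u..v}" "v \<in> {u..v}" using uv by auto
      then have "u \<in> ball x d" "v \<in> ball x d" using uv(3) by blast+
      then have w: "norm (u - x) < d" "norm (v - x) < d" by (auto simp: dist_real_def)
      have "(v - u) *\<^sub>R f' x - (f v - f u)
          = (f u - f x - (u - x) *\<^sub>R f' x) - (f v - f x - (v - x) *\<^sub>R f' x)"
        by (simp add: algebra_simps)
      also have "norm \<dots> \<le> e * norm (u - x) + e * norm (v - x)"
        using d(2)[OF w(1)] d(2)[OF w(2)] by (meson add_mono norm_triangle_ineq4 order_trans)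
      also have "\<dots> = e * (v - u)" using uv by (simp add: algebra_simps)
      also have "\<dots> \<le> e * (H v - H u)"
        using H_ge[of u v] uv e by (intro mult_left_mono) auto
      finally show ?thesis .
    qed
    then show ?thesis using d(1) by blast
  qed
  show ?thesis
    unfolding has_integral_real
  proof (intro allI impI)
    fix e :: real assume "e > 0"
    have Hab: "H b - H a + 1 > 0" using H_ge[OF ab] ab by linarith
    \<comment> \<open>The \<open>+ 1\<close> keeps the denominator positive when
      \<open>a = b\<close> and makes the final bound strict.\<close>
    define e' where "e' = e / (H b - H a + 1)"
    have e': "e' > 0" using \<open>e > 0\<close> Hab by (simp add: e'_def)
    obtain d where d: "\<And>x. x \<in> {a..b} \<Longrightarrow> d x > 0"
      "\<And>x u v. x \<in> {a..b} \<Longrightarrow> u \<le> x \<Longrightarrow> x \<le> v \<Longrightarrow> {u..v} \<subseteq> ball x (d x) \<inter> {a..b} \<Longrightarrow>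
         norm ((v - u) *\<^sub>R f' x - (f v - f u)) \<le> e' * (H v - H u)"
      using local_bound[OF _ e'] by metis
    define \<gamma> where "\<gamma> x = ball x (if x \<in> {a..b} then d x else 1)" for x
    have "gauge \<gamma>" unfolding \<gamma>_def using d(1) by (intro gauge_ball_dependent) auto
    moreover have "norm ((\<Sum>(x, K)\<in>p. measure lborel K *\<^sub>R f' x) - (f b - f a)) < e"
      if p: "p tagged_division_of {a..b}" and fine: "\<gamma> fine p" for p
    proof -
      have "(\<Sum>(x, K)\<in>p. measure lborel K *\<^sub>R f' x) - (f b - f a)
          = (\<Sum>(x, K)\<in>p. measure lborel K *\<^sub>R f' x - (f (Sup K) - f (Inf K)))"
        unfolding additive_tagged_division_1[OF ab p, of f, symmetric]
        by (simp add: split_def sum_subtractf)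
      also have "norm \<dots> \<le> (\<Sum>(x, K)\<in>p. e' * (H (Sup K) - H (Inf K)))"
      proof (rule sum_norm_le, clarify)
        fix x K assume xK: "(x, K) \<in> p"
        obtain u v where K: "K = {u..v}" using tagged_division_ofD(4)[OF p xK] by auto
        have x: "x \<in> K" "K \<subseteq> {a..b}" using tagged_division_ofD(2,3)[OF p xK] by auto
        then have uxv: "u \<le> x" "x \<le> v" "u \<le> v" "x \<in> {a..b}" using K by auto
        have "K \<subseteq> ball x (d x)" using bspec[OF fine[unfolded fine_def] xK] uxv(4) by (simp add: \<gamma>_def)
        then show "norm (measure lborel K *\<^sub>R f' x - (f (Sup K) - f (Inf K))) \<le> e' * (H (Sup K) - H (Inf K))"
          using d(2)[of x u v] x uxv K by simp
      qed
      also have "\<dots> = e' * (H b - H a)"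
        unfolding additive_tagged_division_1[OF ab p, of H, symmetric]
        by (simp add: split_def sum_distrib_left)
      also have "\<dots> < e' * (H b - H a + 1)" using e' by simp
      also have "\<dots> = e" using Hab by (simp add: e'_def)
      finally show ?thesis .
    qed
    ultimately show "\<exists>\<gamma>. gauge \<gamma> \<and> (\<forall>p. p tagged_division_of {a..b} \<and> \<gamma> fine p \<longrightarrow>
        norm ((\<Sum>(x, K)\<in>p. measure lborel K *\<^sub>R f' x) - (f b - f a)) < e)"
      by (intro exI[of _ \<gamma>]) simp
  qed
qed

subsection \<open>Jump operators and delta derivatives\<close>

definition ts_floor :: "real set \<Rightarrow> real \<Rightarrow> real" where
  "ts_floor T u = Sup (T \<inter> {..u})"

text \<open>The jump operator is that of \<open>T\<close> while the approximating points range over \<open>X\<close> only, so that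
  derivatives taken on different intervals of \<open>T\<close> can be compared.\<close>

definition delta_deriv_on ::
    "real set \<Rightarrow> real set \<Rightarrow> (real \<Rightarrow> real) \<Rightarrow> real \<Rightarrow> real \<Rightarrow> bool" where
  "delta_deriv_on T X g d t \<longleftrightarrow> (\<forall>\<epsilon>>0. \<exists>\<delta>>0. \<forall>s\<in>X. \<bar>s - t\<bar> < \<delta> \<longrightarrow>
     \<bar>g (forward_jump T t) - g s - d * (forward_jump T t - s)\<bar> \<le> \<epsilon> * \<bar>forward_jump T t - s\<bar>)"

lemma delta_deriv_on_subset:
  "delta_deriv_on T X g d t \<Longrightarrow> Y \<subseteq> X \<Longrightarrow> delta_deriv_on T Y g d t"
  unfolding delta_deriv_on_def by (meson subsetD)

text \<open>The point \<open>t\<close> itself is an admissible test point \<open>s\<close>, and the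
  error there is below every positive number. This is what makes linear interpolation across a gap
  end at the right value.\<close>

lemma delta_deriv_on_jump:
  assumes "delta_deriv_on T X g d t" "t \<in> X"
  shows "g (forward_jump T t) = g t + d * (forward_jump T t - t)"
proof -
  let ?j = "forward_jump T t"
  have "\<bar>g ?j - g t - d * (?j - t)\<bar> \<le> e" if "e > 0" for e
  proof -
    define e' where "e' = e / (\<bar>?j - t\<bar> + 1)"
    have "e' > 0" using that by (simp add: e'_def)
    then obtain \<delta> where "\<delta> > 0" "\<forall>s\<in>X. \<bar>s - t\<bar> < \<delta> \<longrightarrow>
        \<bar>g ?j - g s - d * (?j - s)\<bar> \<le> e' * \<bar>?j - s\<bar>"
      using assms(1) unfolding delta_deriv_on_def by blast
    then have "\<bar>g ?j - g t - d * (?j - t)\<bar> \<le> e' * \<bar>?j - t\<bar>" using assms(2) by simp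
    also have "\<dots> \<le> e' * (\<bar>?j - t\<bar> + 1)" using \<open>e' > 0\<close> by simp
    also have "\<dots> = e" by (simp add: e'_def add_nonneg_eq_0_iff)
    finally show ?thesis .
  qed
  then have "\<bar>g ?j - g t - d * (?j - t)\<bar> \<le> 0" by (metis field_le_epsilon add_0)
  then show ?thesis by simp
qed

text \<open>Subtracting the identity of \<open>delta_deriv_on_jump\<close> from the estimate at
  \<open>s\<close> leaves \<open>d * (s - t)\<close> and an error kept small by the bounded distance
  to the jump point.\<close>

lemma delta_deriv_on_continuous:
  assumes D: "delta_deriv_on T X g d t" and t: "t \<in> X"
  shows "continuous (at t within X) g"
  unfolding continuous_within_eps_delta
proof (intro allI impI)
  fix e :: real assume "e > 0"
  let ?j = "forward_jump T t"
  define c where "c = \<bar>?j - t\<bar> + 1"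
  have c: "c > 0" by (auto simp: c_def)
  define e' where "e' = e / (2 * c)"
  have e': "e' > 0" using \<open>e > 0\<close> c by (simp add: e'_def)
  then obtain \<delta> where \<delta>: "\<delta> > 0" "\<And>s. s\<in>X \<Longrightarrow> \<bar>s - t\<bar> < \<delta> \<Longrightarrow>
      \<bar>g ?j - g s - d * (?j - s)\<bar> \<le> e' * \<bar>?j - s\<bar>"
    using D unfolding delta_deriv_on_def by blast
  define r where "r = min \<delta> (min 1 (e / (2 * (\<bar>d\<bar> + 1))))"
  have r: "r > 0" using \<delta>(1) \<open>e > 0\<close> by (simp add: r_def)
  have "\<bar>g s - g t\<bar> < e" if s: "s \<in> X" "\<bar>s - t\<bar> < r" for s
  proof -
    have 1: "\<bar>g ?j - g s - d * (?j - s)\<bar> \<le> e' * \<bar>?j - s\<bar>"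
      using \<delta>(2) s by (simp add: r_def)
    have "\<bar>s - t\<bar> < 1" using s by (simp add: r_def)
    then have "\<bar>?j - s\<bar> \<le> c" by (simp add: c_def)
    then have "e' * \<bar>?j - s\<bar> \<le> e' * c" using e' by simp
    also have "\<dots> = e / 2" using c by (simp add: e'_def)
    finally have 2: "\<bar>g ?j - g s - d * (?j - s)\<bar> \<le> e / 2" using 1 by linarith
    have "\<bar>d * (s - t)\<bar> = \<bar>d\<bar> * \<bar>s - t\<bar>" by (simp add: abs_mult)
    also have "\<dots> \<le> (\<bar>d\<bar> + 1) * \<bar>s - t\<bar>" by (simp add: mult_right_mono)
    also have "\<dots> < (\<bar>d\<bar> + 1) * (e / (2 * (\<bar>d\<bar> + 1)))"
      using s(2) unfolding r_def by (intro mult_strict_left_mono) auto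
    also have "\<dots> = e / 2" by (simp add: divide_simps add_nonneg_eq_0_iff)
    finally have 3: "\<bar>d * (s - t)\<bar> < e / 2" .
    have "g s - g t = d * (s - t) - (g ?j - g s - d * (?j - s))"
      using delta_deriv_on_jump[OF D t] by (simp add: algebra_simps)
    then show ?thesis using 2 3 by linarith
  qed
  then show "\<exists>d>0. \<forall>x'\<in>X. dist x' t < d \<longrightarrow> dist (g x') (g t) < e"
    using r by (auto simp: dist_real_def)
qed

text \<open>The product rule with one linear factor. The derivative 1 of that factor multiplies
  \<open>g\<close> at the jump point, which is the origin of the shifted values in the Montgomery
  identity.\<close>

lemma delta_deriv_on_mult_linear:
  assumes D: "delta_deriv_on T X g d t"
  shows "delta_deriv_on T X (\<lambda>t. (t - k) * g t) (g (forward_jump T t) + (t - k) * d) t"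
  unfolding delta_deriv_on_def
proof (intro allI impI)
  fix e :: real assume "e > 0"
  let ?j = "forward_jump T t"
  define c where "c = \<bar>t - k\<bar> + 1"
  have c: "c > 0" by (auto simp: c_def)
  define e' where "e' = e / (2 * c)"
  have e': "e' > 0" using \<open>e > 0\<close> c by (simp add: e'_def)
  then obtain \<delta> where \<delta>: "\<delta> > 0" "\<And>s. s\<in>X \<Longrightarrow> \<bar>s - t\<bar> < \<delta> \<Longrightarrow>
      \<bar>g ?j - g s - d * (?j - s)\<bar> \<le> e' * \<bar>?j - s\<bar>"
    using D unfolding delta_deriv_on_def by blast
  define r where "r = min \<delta> (min 1 (e / (2 * (\<bar>d\<bar> + 1))))"
  have r: "r > 0" using \<delta>(1) \<open>e > 0\<close> by (simp add: r_def)
  have "\<bar>(?j - k) * g ?j - (s - k) * g s - (g ?j + (t - k) * d) * (?j - s)\<bar> \<le> e * \<bar>?j - s\<bar>"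
    if s: "s \<in> X" "\<bar>s - t\<bar> < r" for s
  proof -
    define w where "w = g ?j - g s - d * (?j - s)"
    have 1: "\<bar>w\<bar> \<le> e' * \<bar>?j - s\<bar>"
      using \<delta>(2) s by (simp add: r_def w_def)
    have "\<bar>s - t\<bar> < 1" using s by (simp add: r_def)
    then have "\<bar>s - k\<bar> \<le> c" unfolding c_def by linarith
    then have "\<bar>(s - k) * w\<bar> \<le> c * (e' * \<bar>?j - s\<bar>)"
      using 1 c unfolding abs_mult by (intro mult_mono) auto
    then have 2: "\<bar>(s - k) * w\<bar> \<le> e / 2 * \<bar>?j - s\<bar>" using c by (simp add: e'_def)
    have "\<bar>(s - t) * d\<bar> \<le> e / (2 * (\<bar>d\<bar> + 1)) * (\<bar>d\<bar> + 1)"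
      using s(2) unfolding r_def abs_mult using \<open>e > 0\<close> by (intro mult_mono) auto
    also have "\<dots> = e / 2" by (simp add: divide_simps add_nonneg_eq_0_iff)
    finally have 3: "\<bar>(s - t) * d * (?j - s)\<bar> \<le> e / 2 * \<bar>?j - s\<bar>"
      unfolding abs_mult[of "(s - t) * d"] by (rule mult_right_mono) simp
    \<comment> \<open>The error of the product is the error \<open>w\<close> of \<open>g\<close>
      times a bounded factor, plus a term carrying the small factor \<open>s - t\<close>.\<close>
    have "(?j - k) * g ?j - (s - k) * g s - (g ?j + (t - k) * d) * (?j - s)
        = (s - k) * w + (s - t) * d * (?j - s)"
      by (simp add: w_def algebra_simps)
    then show ?thesis using 2 3 by linarith
  qed
  then show "\<exists>\<delta>>0. \<forall>s\<in>X. \<bar>s - t\<bar> < \<delta> \<longrightarrow> \<bar>(?j - k) * g ?j - (s - k) * g s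
      - (g ?j + (t - k) * d) * (?j - s)\<bar> \<le> e * \<bar>?j - s\<bar>"
    using r by blast
qed

section \<open>Order properties of the forward jump\<close>

lemma forward_jump_ge: "t \<le> forward_jump T t"
  unfolding forward_jump_def by (auto intro!: cInf_greatest)

lemma forward_jump_le: "s \<in> T \<Longrightarrow> t < s \<Longrightarrow> forward_jump T t \<le> s"
  unfolding forward_jump_def by (auto intro!: cInf_lower bdd_belowI[of _ t])

lemma right_dense_approx:
  assumes "forward_jump T t = t" "s \<in> T" "t < s" "\<epsilon> > 0"
  shows "\<exists>r\<in>T. t < r \<and> r < t + \<epsilon>"
proof (rule ccontr)
  assume neg: "\<not> (\<exists>r\<in>T. t < r \<and> r < t + \<epsilon>)"
  have "t + \<epsilon> \<le> Inf {s\<in>T. t < s}"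
    using assms neg by (intro cInf_greatest) force+
  then show False using assms unfolding forward_jump_def by (auto split: if_splits)
qed

text \<open>Monotonicity on the whole line is what makes the jump operator Borel measurable.\<close>

lemma mono_forward_jump: "mono (forward_jump T)"
proof (rule monoI)
  fix u v :: real assume uv: "u \<le> v"
  consider "\<exists>s\<in>T. v < s" | "\<not> (\<exists>s\<in>T. v < s)" by blast
  then show "forward_jump T u \<le> forward_jump T v"
  proof cases
    case 1
    then have "forward_jump T v = Inf {s\<in>T. v < s}" by (simp add: forward_jump_def)
    moreover have "forward_jump T u \<le> Inf {s\<in>T. v < s}"
      using 1 uv by (intro cInf_greatest) (auto intro: forward_jump_le)
    ultimately show ?thesis by simp
  next
    case 2
    show ?thesis
    proof (cases "\<exists>s\<in>T. u < s")
      case True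
      then obtain s where "s \<in> T" "u < s" by blast
      then show ?thesis using 2 forward_jump_le[of s T u] forward_jump_ge[of v T] by force
    next
      case False
      then show ?thesis using uv forward_jump_ge[of v T] by (simp add: forward_jump_def)
    qed
  qed
qed

text \<open>Lets the jump operators of \<open>T \<inter> {a..c}\<close> and
  \<open>T \<inter> {a..b}\<close> be exchanged for that of \<open>T\<close> at points below
  \<open>b\<close>.\<close>

lemma forward_jump_Int:
  assumes "X \<subseteq> T" "y \<in> X" "t < y" "T \<inter> {t..y} \<subseteq> X"
  shows "forward_jump X t = forward_jump T t"
proof (rule antisym)
  have XT: "forward_jump X t = Inf {s\<in>X. t < s}" "forward_jump T t = Inf {s\<in>T. t < s}"
    using assms by (auto simp: forward_jump_def)
  show "forward_jump T t \<le> forward_jump X t"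
    unfolding XT(1) using assms by (intro cInf_greatest) (auto intro: forward_jump_le)
  have "forward_jump X t \<le> s" if "s \<in> T" "t < s" for s
  proof (cases "s \<le> y")
    case True
    then show ?thesis using that assms by (intro forward_jump_le) auto
  next
    case False
    then show ?thesis using forward_jump_le[OF assms(2,3)] by linarith
  qed
  then show "forward_jump X t \<le> forward_jump T t"
    unfolding XT(2) using assms by (intro cInf_greatest) auto
qed

text \<open>The gaps to the right of these points are pairwise disjoint open intervals, and each
  contains a rational.\<close>

lemma countable_right_scattered: "countable {t\<in>T. t < forward_jump T t}"
proof -
  let ?S = "{t\<in>T. t < forward_jump T t}"
  have "\<exists>q::rat. t < of_rat q \<and> of_rat q < forward_jump T t" if "t \<in> ?S" for t
    using that of_rat_dense by auto
  then obtain q :: "real \<Rightarrow> rat"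
    where q: "\<And>t. t \<in> ?S \<Longrightarrow> t < of_rat (q t) \<and> of_rat (q t) < forward_jump T t"
    by metis
  have "inj_on q ?S"
  proof (rule linorder_inj_onI)
    fix s t assume "s < t" "s \<in> ?S" "t \<in> ?S"
    then have "of_rat (q s) < (of_rat (q t) :: real)"
      using q[of s] q[of t] forward_jump_le[of t T s] by auto
    then show "q s \<noteq> q t" by auto
  qed auto
  then show ?thesis by (rule countableI')
qed

section \<open>Rounding down to a closed set, and the gaps of that set\<close>

context
  fixes T :: "real set"
  assumes cl: "closed T"
begin

lemma forward_jump_mem:
  assumes "s \<in> T" "t < s"
  shows "forward_jump T t \<in> insert t T"
proof (cases "forward_jump T t = t")
  case False
  then have gt: "t < forward_jump T t" using forward_jump_ge[of t T] by linarith
  \<comment> \<open>Beyond a nonempty gap the points of \<open>T\<close> after \<open>t\<close> form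
    a closed set, so their infimum is attained.\<close>
  have eq: "{s\<in>T. t < s} = T \<inter> {forward_jump T t..}"
    using gt forward_jump_le[of _ T t] by force
  have "Inf (T \<inter> {forward_jump T t..}) \<in> T \<inter> {forward_jump T t..}"
    using assms cl forward_jump_le[of s T t]
    by (intro closed_contains_Inf) (auto intro: closed_Int)
  then show ?thesis using assms eq by (auto simp: forward_jump_def)
qed simp

lemma ts_floor_props:
  assumes "x \<in> T" "x \<le> u"
  shows "ts_floor T u \<in> T" "ts_floor T u \<le> u" "x \<le> ts_floor T u"
proof -
  have "ts_floor T u \<in> T \<inter> {..u}"
    unfolding ts_floor_def using assms cl
    by (intro closed_contains_Sup) (auto intro: closed_Int)
  then show "ts_floor T u \<in> T" "ts_floor T u \<le> u" by auto
  show "x \<le> ts_floor T u"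
    unfolding ts_floor_def using assms by (intro cSup_upper) auto
qed

lemma ts_floor_less_iff:
  assumes "x \<in> T" "x \<le> u" "y \<in> T"
  shows "ts_floor T u < y \<longleftrightarrow> u < y"
  using ts_floor_props[of x u] ts_floor_props(3)[of y u] assms by fastforce

lemma ts_floor_self: "u \<in> T \<Longrightarrow> ts_floor T u = u"
  using ts_floor_props[of u u] by auto

lemma ts_floor_gap:
  assumes "t \<in> T" "t \<le> u" "u < forward_jump T t"
  shows "ts_floor T u = t"
  using ts_floor_props[of t u] assms forward_jump_le[of "ts_floor T u" T t] by force

text \<open>The left end of the gap is \<open>ts_floor T u\<close>. Were it right-dense, points of
  \<open>T\<close> strictly between it and \<open>u\<close> would contradict its maximality.\<close>

lemma gap_around:
  assumes "x \<in> T" "x \<le> u" "u \<notin> T" "y \<in> T" "u \<le> y"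
  obtains t where "t \<in> T" "x \<le> t" "t < u" "u < forward_jump T t" "forward_jump T t \<le> y"
    "forward_jump T t \<in> T" "ts_floor T u = t"
proof -
  let ?t = "ts_floor T u"
  have t: "?t \<in> T" "?t \<le> u" "x \<le> ?t" "?t \<noteq> u"
    using ts_floor_props[OF assms(1,2)] assms by auto
  have ty: "?t < y" using t assms by linarith
  have "?t < forward_jump T ?t"
  proof (rule ccontr)
    assume "\<not> ?t < forward_jump T ?t"
    then have "forward_jump T ?t = ?t" using forward_jump_ge[of ?t T] by simp
    then obtain r where "r \<in> T" "?t < r" "r < ?t + (u - ?t)"
      using right_dense_approx[of T ?t y "u - ?t"] assms t ty by auto
    then show False using ts_floor_props(3)[of r u] by auto
  qed
  then have j: "forward_jump T ?t \<in> T" using forward_jump_mem[OF assms(4) ty] by auto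
  moreover have "u < forward_jump T ?t"
    using ts_floor_props(3)[of "forward_jump T ?t" u] j assms(3) \<open>?t < forward_jump T ?t\<close>
    by fastforce
  ultimately show ?thesis
    using that[of ?t] t forward_jump_le[OF assms(4) ty] by auto
qed

end

subsection \<open>The fundamental theorem on a time scale\<close>

text \<open>If a strip just left of \<open>u\<close> contained no point of \<open>T\<close>, its
  midpoint would lie in a gap, and the right end of that gap could only be \<open>u\<close>.\<close>

lemma left_dense_approx:
  assumes cl: "closed T" and x: "x \<in> T" "x < u" and u: "u \<in> T"
    and dense: "\<And>t. t \<in> T \<Longrightarrow> t < u \<Longrightarrow> forward_jump T t \<noteq> u" and "\<epsilon> > 0"
  shows "\<exists>l\<in>T. x \<le> l \<and> l < u \<and> u - \<epsilon> < l"
proof (rule ccontr)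
  assume neg: "\<not> ?thesis"
  define w where "w = (max x (u - \<epsilon>) + u) / 2"
  have w: "x \<le> w" "w < u" "u - \<epsilon> < w" using x \<open>\<epsilon> > 0\<close> by (auto simp: w_def max_def)
  then have "w \<notin> T" using neg by blast
  then obtain t where t: "t \<in> T" "x \<le> t" "t < w" "w < forward_jump T t"
      "forward_jump T t \<le> u" "forward_jump T t \<in> T"
    using gap_around[OF cl x(1) w(1) _ u] w by (metis less_imp_le)
  then have "forward_jump T t = u" using neg w by force
  then show False using dense[of t] t w by auto
qed

theorem delta_fundamental_theorem:
  fixes g g' :: "real \<Rightarrow> real"
  assumes cl: "closed T" and x: "x \<in> T" and y: "y \<in> T" and xy: "x \<le> y"
    and D: "\<And>t. t \<in> T \<Longrightarrow> x \<le> t \<Longrightarrow> t < y \<Longrightarrow> delta_deriv_on T (T \<inter> {x..y}) g (g' t) t"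
    and cont: "continuous_on (T \<inter> {x..y}) g"
  shows "((\<lambda>u. g' (ts_floor T u)) has_integral g y - g x) {x..y}"
proof -
  \<comment> \<open>Off \<open>T\<close> the slope is \<open>g'\<close> at the left end of the gap,
    so there the derivative of \<open>G\<close> is the desired integrand by construction.\<close>
  define G where "G u = (if u \<in> T then g u
      else g (ts_floor T u) + g' (ts_floor T u) * (u - ts_floor T u))" for u
  have lin: "G u = g t + g' t * (u - t)"
    if "t \<in> T" "x \<le> t" "t < y" "t \<le> u" "u \<le> forward_jump T t" for t u
  proof (cases "u \<in> T")
    case True
    then have "u = t \<or> u = forward_jump T t" using that forward_jump_le[of u T t] by force
    then show ?thesis
      using delta_deriv_on_jump[OF D[OF that(1-3)]] that True by (auto simp: G_def)
  next
    case False
    then have "u < forward_jump T t"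
      using that forward_jump_mem[OF cl y that(3)] by (metis insert_iff order.order_iff_strict)
    then show ?thesis
      using False ts_floor_gap[OF cl that(1,4)] by (simp add: G_def)
  qed
  \<comment> \<open>\<open>G\<close> at a point between \<open>l\<close> and \<open>r\<close> is a
    convex combination of values of \<open>g\<close> at points of \<open>T\<close> between
    \<open>l\<close> and \<open>r\<close>, with the weights that give the point itself. Estimates on
    \<open>T\<close> thus pass to \<open>G\<close> by convexity.\<close>
  have bracket: "\<exists>t\<in>T. \<exists>j\<in>T. \<exists>m. l \<le> t \<and> t \<le> r \<and> l \<le> j \<and> j \<le> r \<and> 0 \<le> m \<and> m \<le> 1 \<and>
      v = (1 - m) * t + m * j \<and> G v = (1 - m) * g t + m * g j"
    if lr: "l \<in> T" "r \<in> T" "x \<le> l" "r \<le> y" and v: "l \<le> v" "v \<le> r" for l r v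
  proof (cases "v \<in> T")
    case True
    then show ?thesis
      using v by (intro bexI[of _ v] exI[of _ 0]) (auto simp: G_def)
  next
    case False
    obtain t where t: "t \<in> T" "l \<le> t" "t < v" "v < forward_jump T t" "forward_jump T t \<le> r"
        "forward_jump T t \<in> T"
      using gap_around[OF cl lr(1) v(1) False lr(2) v(2)] by metis
    define j where "j = forward_jump T t"
    define m where "m = (v - t) / (j - t)"
    have tj: "t < v" "v < j" using t by (auto simp: j_def)
    have mj: "m * (j - t) = v - t" using tj by (simp add: m_def)
    have m: "0 \<le> m" "m \<le> 1" using tj by (auto simp: m_def)
    have ty: "x \<le> t" "t < y" using t lr by linarith+
    have gj: "g j = g t + g' t * (j - t)"
      using lin[of t j] t ty tj by (simp add: j_def G_def)
    have "v = (1 - m) * t + m * j" using mj by (simp add: algebra_simps)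
    moreover have "G v = g t + g' t * (m * (j - t))"
      using lin[of t v] t ty by (simp add: mj)
    then have "G v = (1 - m) * g t + m * g j" by (simp add: gj algebra_simps)
    ultimately show ?thesis
      using t tj m by (intro bexI[of _ t] bexI[of _ j] exI[of _ m]) (auto simp: j_def)
  qed
  \<comment> \<open>Both ends of every gap, where \<open>G\<close> may have a corner.\<close>
  define E where "E = {t\<in>T. t < forward_jump T t} \<union> forward_jump T ` {t\<in>T. t < forward_jump T t}"
  have "countable E" unfolding E_def using countable_right_scattered[of T] by auto
  have gapD: "(G has_real_derivative g' (ts_floor T u)) (at u)"
    if u: "x \<le> u" "u \<le> y" "u \<notin> T" for u
  proof -
    obtain t where t: "t \<in> T" "x \<le> t" "t < u" "u < forward_jump T t"
        "ts_floor T u = t"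
      using gap_around[OF cl x u(1,3) y u(2)] by metis
    have "((\<lambda>u. g t + g' t * (u - t)) has_real_derivative g' t) (at u)"
      by (auto intro!: derivative_eq_intros)
    then show ?thesis
      unfolding t(5)
      by (rule has_field_derivative_transform_within_open[of _ _ _ "{t<..<forward_jump T t}"])
        (use t u lin in auto)
  qed
  \<comment> \<open>Outside \<open>E\<close> the point \<open>u\<close> is a limit of
    \<open>T\<close> from both sides, so the neighbourhood can be given end points \<open>l\<close>
    and \<open>r\<close> in \<open>T\<close> close to \<open>u\<close>.\<close>
  have denseD: "(G has_real_derivative g' u) (at u)"
    if u: "x < u" "u < y" "u \<in> T" "u \<notin> E" for u
    unfolding has_field_derivative_def has_derivative_at_alt
  proof (intro conjI allI impI)
    show "bounded_linear ((*) (g' u))" by (rule bounded_linear_mult_right)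
  next
    fix e :: real assume "e > 0"
    have ju: "forward_jump T u = u" using u forward_jump_ge[of u T] by (force simp: E_def)
    obtain \<delta> where \<delta>: "\<delta> > 0" "\<And>s. s\<in>T\<inter>{x..y} \<Longrightarrow> \<bar>s - u\<bar> < \<delta> \<Longrightarrow>
        \<bar>g u - g s - g' u * (u - s)\<bar> \<le> e * \<bar>u - s\<bar>"
      using D[OF u(3)] u \<open>e > 0\<close> unfolding delta_deriv_on_def ju by force
    obtain r where r: "r \<in> T" "u < r" "r < u + min \<delta> (y - u)"
      using right_dense_approx[OF ju y u(2), of "min \<delta> (y - u)"] \<delta> u by auto
    obtain l where l: "l \<in> T" "x \<le> l" "l < u" "u - \<delta> < l"
      using left_dense_approx[OF cl x u(1,3) _ \<delta>(1)] u(4) by (force simp: E_def)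
    have est: "\<bar>G v - G u - g' u * (v - u)\<bar> \<le> e * \<bar>v - u\<bar>" if v: "l \<le> v" "v \<le> r" for v
    proof -
      \<comment> \<open>The bracket is kept on one side of \<open>u\<close>. Then
        \<open>u - t\<close> and \<open>u - j\<close> have the same sign, and the weighted distances
        add up to exactly \<open>\<bar>v - u\<bar>\<close>.\<close>
      obtain l' r' where lr': "l' \<in> T" "r' \<in> T" "l \<le> l'" "r' \<le> r" "l' \<le> v" "v \<le> r'"
          "u \<le> l' \<or> r' \<le> u"
        using v l r u by (cases "v \<le> u") force+
      obtain t j m where tj: "t \<in> T" "j \<in> T" "l' \<le> t" "t \<le> r'" "l' \<le> j" "j \<le> r'" "0 \<le> m"
          "m \<le> 1" and v_eq: "v = (1 - m) * t + m * j" and Gv: "G v = (1 - m) * g t + m * g j"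
        using bracket[of l' r' v] lr' l r by (auto simp: min_def split: if_splits)
      have 1: "\<bar>g u - g t - g' u * (u - t)\<bar> \<le> e * \<bar>u - t\<bar>"
        by (rule \<delta>(2)) (use tj lr' l r in \<open>auto simp: min_def split: if_splits\<close>)
      have 2: "\<bar>g u - g j - g' u * (u - j)\<bar> \<le> e * \<bar>u - j\<bar>"
        by (rule \<delta>(2)) (use tj lr' l r in \<open>auto simp: min_def split: if_splits\<close>)
      have Gu: "G u = g u" using u by (simp add: G_def)
      have "G v - G u - g' u * (v - u)
          = (1 - m) * g t + m * g j - g u - g' u * ((1 - m) * t + m * j - u)"
        by (simp only: Gv Gu flip: v_eq)
      also have "\<dots>
          = - ((1 - m) * (g u - g t - g' u * (u - t)) + m * (g u - g j - g' u * (u - j)))"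
        by (simp add: algebra_simps)
      finally have "\<bar>G v - G u - g' u * (v - u)\<bar>
          \<le> \<bar>(1 - m) * (g u - g t - g' u * (u - t))\<bar> + \<bar>m * (g u - g j - g' u * (u - j))\<bar>"
        by linarith
      also have "\<dots> \<le> (1 - m) * (e * \<bar>u - t\<bar>) + m * (e * \<bar>u - j\<bar>)"
        using 1 2 tj by (intro add_mono) (auto simp: abs_mult intro!: mult_left_mono)
      also have "\<dots> = e * ((1 - m) * \<bar>u - t\<bar> + m * \<bar>u - j\<bar>)" by (simp add: algebra_simps)
      also have "(1 - m) * \<bar>u - t\<bar> + m * \<bar>u - j\<bar> = \<bar>v - u\<bar>"
      proof (cases "u \<le> l'")
        case True
        then have "\<bar>u - t\<bar> = t - u" "\<bar>u - j\<bar> = j - u" "\<bar>v - u\<bar> = v - u"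
          using tj lr' by auto
        then show ?thesis by (simp add: v_eq algebra_simps)
      next
        case False
        then have "\<bar>u - t\<bar> = u - t" "\<bar>u - j\<bar> = u - j" "\<bar>v - u\<bar> = u - v"
          using tj lr' by auto
        then show ?thesis by (simp add: v_eq algebra_simps)
      qed
      finally show ?thesis .
    qed
    show "\<exists>d>0. \<forall>v. norm (v - u) < d \<longrightarrow>
        norm (G v - G u - g' u * (v - u)) \<le> e * norm (v - u)"
      using est l r by (intro exI[of _ "min (u - l) (r - u)"]) auto
  qed
  have contG: "continuous_on {x..y} G"
    unfolding continuous_on_eq_continuous_within
  proof
    fix u assume u: "u \<in> {x..y}"
    show "continuous (at u within {x..y}) G"
    proof (cases "u \<in> T")
      case False
      then show ?thesis
        using gapD[of u] u by (auto intro: DERIV_continuous continuous_at_imp_continuous_at_within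
            simp: DERIV_isCont)
    next
      case True
      have "\<exists>d>0. \<forall>v\<in>{x..y}. dist v u < d \<longrightarrow> dist (G v) (G u) < e" if "e > 0" for e
      proof -
        obtain \<delta> where \<delta>: "\<delta> > 0"
            "\<And>s. s \<in> T \<Longrightarrow> x \<le> s \<Longrightarrow> s \<le> y \<Longrightarrow> \<bar>s - u\<bar> < \<delta> \<Longrightarrow> \<bar>g s - g u\<bar> < e"
          using cont True u \<open>e > 0\<close> unfolding continuous_on_iff
          by (force simp: dist_real_def)
        have est: "\<bar>G v - G u\<bar> < e"
          if lr: "l \<in> T" "r \<in> T" "x \<le> l" "r \<le> y" "l \<le> v" "v \<le> r"
            and near: "u - \<delta> < l" "r < u + \<delta>" for l r v
        proof -
          obtain t j m where tj: "t \<in> T" "j \<in> T" "l \<le> t" "t \<le> r" "l \<le> j" "j \<le> r" "0 \<le> m"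
              "m \<le> 1" and Gv: "G v = (1 - m) * g t + m * g j"
            using bracket[OF lr] by blast
          have 1: "\<bar>g t - g u\<bar> < e" "\<bar>g j - g u\<bar> < e" using tj lr near by (auto intro!: \<delta>(2))
          have "(1 - m) * g t + m * g j \<in> {g u - e<..<g u + e}"
            using convexD_alt[OF convex_real_interval(8)[of "g u - e" "g u + e"], of "g t" "g j" m] 1 tj
            by (auto simp: abs_less_iff)
          then show ?thesis using Gv True by (auto simp: G_def)
        qed
        \<comment> \<open>Each side of \<open>u\<close> is treated separately: on a dense side
          nearby points of \<open>T\<close> bracket \<open>v\<close>, on a scattered side
          \<open>G\<close> is linear on the adjacent gap.\<close>
        have R: "\<exists>d>0. \<forall>v\<in>{x..y}. u \<le> v \<longrightarrow> v < u + d \<longrightarrow> \<bar>G v - G u\<bar> < e"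
        proof (cases "u = y")
          case True
          then show ?thesis using \<open>e > 0\<close> by (intro exI[of _ 1]) auto
        next
          case False
          then have uy: "u < y" using u by auto
          show ?thesis
          proof (cases "forward_jump T u = u")
            case True
            then obtain r where r: "r \<in> T" "u < r" "r < u + min \<delta> (y - u)"
              using right_dense_approx[OF True y uy, of "min \<delta> (y - u)"] \<delta> uy by auto
            then show ?thesis
              using est[of u r] \<open>u \<in> T\<close> u \<delta>(1) by (intro exI[of _ "r - u"]) auto
          next
            case False
            then have ju: "u < forward_jump T u" using forward_jump_ge[of u T] by simp
            have "\<bar>G v - G u\<bar> < e" if "u \<le> v" "v < u + min (forward_jump T u - u) (e / (\<bar>g' u\<bar> + 1))" for v
            proof -
              have "G v - G u = g' u * (v - u)"
                using lin[of u v] lin[of u u] that \<open>u \<in> T\<close> u uy ju by auto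
              then have "\<bar>G v - G u\<bar> \<le> (\<bar>g' u\<bar> + 1) * (v - u)"
                using that by (auto simp: abs_mult intro!: mult_right_mono)
              also have "\<dots> < (\<bar>g' u\<bar> + 1) * (e / (\<bar>g' u\<bar> + 1))"
                using that by (intro mult_strict_left_mono) auto
              finally show ?thesis by (simp add: add_nonneg_eq_0_iff)
            qed
            then show ?thesis
              using ju \<open>e > 0\<close>
              by (intro exI[of _ "min (forward_jump T u - u) (e / (\<bar>g' u\<bar> + 1))"]) auto
          qed
        qed
        have L: "\<exists>d>0. \<forall>v\<in>{x..y}. v \<le> u \<longrightarrow> u - d < v \<longrightarrow> \<bar>G v - G u\<bar> < e"
        proof (cases "u = x")
          case True
          then show ?thesis using \<open>e > 0\<close> by (intro exI[of _ 1]) auto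
        next
          case False
          then have ux: "x < u" using u by auto
          show ?thesis
          proof (cases "\<exists>t\<in>T. t < u \<and> forward_jump T t = u")
            case True
            then obtain t where t: "t \<in> T" "t < u" "forward_jump T t = u" by blast
            have xt: "x \<le> t" using forward_jump_le[OF x, of t] t ux by force
            have "\<bar>G v - G u\<bar> < e" if "v \<le> u" "u - min (u - t) (e / (\<bar>g' t\<bar> + 1)) < v" for v
            proof -
              have "t \<le> v" "v \<le> forward_jump T t" using that t(3) by linarith+
              then have "G v - G u = g' t * (v - u)"
                using lin[of t v] lin[of t u] t u xt by (auto simp: algebra_simps)
              then have "\<bar>G v - G u\<bar> \<le> (\<bar>g' t\<bar> + 1) * (u - v)"
                using that by (auto simp: abs_mult intro!: mult_right_mono)
              also have "\<dots> < (\<bar>g' t\<bar> + 1) * (e / (\<bar>g' t\<bar> + 1))"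
                using that by (intro mult_strict_left_mono) auto
              finally show ?thesis by (simp add: add_nonneg_eq_0_iff)
            qed
            then show ?thesis
              using t \<open>e > 0\<close>
              by (intro exI[of _ "min (u - t) (e / (\<bar>g' t\<bar> + 1))"]) auto
          next
            case False
            then obtain l where l: "l \<in> T" "x \<le> l" "l < u" "u - \<delta> < l"
              using left_dense_approx[OF cl x ux \<open>u \<in> T\<close> _ \<delta>(1)] by blast
            then show ?thesis
              using est[of l u] \<open>u \<in> T\<close> u \<delta>(1) by (intro exI[of _ "u - l"]) auto
          qed
        qed
        obtain d1 where d1: "d1 > 0" "\<forall>v\<in>{x..y}. u \<le> v \<longrightarrow> v < u + d1 \<longrightarrow> \<bar>G v - G u\<bar> < e"
          using R by blast
        obtain d2 where d2: "d2 > 0" "\<forall>v\<in>{x..y}. v \<le> u \<longrightarrow> u - d2 < v \<longrightarrow> \<bar>G v - G u\<bar> < e"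
          using L by blast
        have "dist (G v) (G u) < e" if "v \<in> {x..y}" "dist v u < min d1 d2" for v
          using d1(2)[rule_format, OF that(1)] d2(2)[rule_format, OF that(1)] that(2)
          by (cases "u \<le> v") (auto simp: dist_real_def)
        then show ?thesis using d1(1) d2(1) by (intro exI[of _ "min d1 d2"]) auto
      qed
      then show ?thesis unfolding continuous_within_eps_delta by blast
    qed
  qed
  have "((\<lambda>u. g' (ts_floor T u)) has_integral G y - G x) {x..y}"
  proof (rule fundamental_theorem_of_calculus_countable[OF \<open>countable E\<close> xy _ contG])
    fix u assume "u \<in> {x<..<y} - E"
    then show "(G has_vector_derivative g' (ts_floor T u)) (at u)"
      using gapD[of u] denseD[of u] ts_floor_self[OF cl, of u]
      by (cases "u \<in> T") (auto simp: has_real_derivative_iff_has_vector_derivative)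
  qed
  then show ?thesis using x y by (simp add: G_def)
qed

subsection \<open>Delta integrals as integrals over real intervals\<close>

text \<open>An arbitrary threshold \<open>y\<close> is replaced by the least point of
  \<open>T\<close> at or above it, clipped to \<open>[a,b]\<close>. Preimages of rays then become
  intervals ending in \<open>T\<close>, whose delta measure is known.\<close>

lemma lessThan_cut:
  assumes cl: "closed T" and a: "a \<in> T" and b: "b \<in> T" and ab: "a \<le> b"
  shows "\<exists>t\<in>T. a \<le> t \<and> t \<le> b \<and> (\<forall>s\<in>T \<inter> {a..<b}. s < y \<longleftrightarrow> s < t) \<and>
    (\<forall>u\<in>{a..<b}. ts_floor T u < y \<longleftrightarrow> u < t)"
proof -
  have "\<exists>t\<in>T. a \<le> t \<and> t \<le> b \<and> (\<forall>s\<in>T \<inter> {a..<b}. s < y \<longleftrightarrow> s < t)"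
  proof (cases "y \<le> b")
    case False
    then show ?thesis using b ab by (intro bexI[of _ b]) auto
  next
    case True
    show ?thesis
    proof (cases "y \<le> a")
      case True
      then show ?thesis using a ab by (intro bexI[of _ a]) auto
    next
      case False
      define t where "t = Inf (T \<inter> {y..})"
      have "t \<in> T \<inter> {y..}"
        unfolding t_def using \<open>y \<le> b\<close> b cl
        by (intro closed_contains_Inf) (auto intro: closed_Int)
      moreover have "t \<le> s" if "s \<in> T" "y \<le> s" for s
        unfolding t_def using that by (intro cInf_lower) auto
      ultimately show ?thesis
        using False \<open>y \<le> b\<close> b by (intro bexI[of _ t]) force+
    qed
  qed
  then obtain t where t: "t \<in> T" "a \<le> t" "t \<le> b" "\<And>s. s \<in> T \<inter> {a..<b} \<Longrightarrow> s < y \<longleftrightarrow> s < t"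
    by blast
  moreover have "ts_floor T u < y \<longleftrightarrow> u < t" if "u \<in> {a..<b}" for u
    using t(4)[of "ts_floor T u"] ts_floor_props[OF cl a, of u]
      ts_floor_less_iff[OF cl a _ t(1), of u] that by auto
  ultimately show ?thesis by blast
qed

text \<open>Both integrals are integrals of \<open>g\<close> against image measures on the line.
  These are finite and agree on the rays \<open>{..<y}\<close>, an intersection-stable generator of
  the Borel sets.\<close>

lemma delta_integral_eq_lborel:
  assumes T: "time_scale T" and a: "a \<in> T" and b: "b \<in> T" and ab: "a \<le> b"
    and g: "g \<in> borel_measurable borel"
  shows "set_borel_measurable lborel {a..<b} (\<lambda>u. g (ts_floor T u))"
    and "delta_integral T a b g = (LINT u:{a..<b}|lborel. g (ts_floor T u))"
proof -
  have cl: "closed T" using T by (simp add: time_scale_def)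
  let ?D = "delta_measure T"
  define S where "S = T \<inter> {a..<b}"
  let ?G = "(\<lambda>(s, t). T \<inter> {s..<t}) ` {(s, t). s \<in> T \<and> t \<in> T \<and> s \<le> t}"
  have "?G \<subseteq> Pow T" by auto
  then have sets: "sets ?D = sigma_sets T ?G"
    unfolding delta_measure_def by (intro sets_extend_measure) auto
  have int: "T \<inter> {s..<t} \<in> sets ?D" if "s \<in> T" "t \<in> T" "s \<le> t" for s t
    unfolding sets using that by (intro sigma_sets.Basic) auto
  have S: "S \<in> sets ?D" unfolding S_def using a b ab by (rule int)
  define M0 where "M0 = restrict_space ?D S"
  have sp0: "space M0 = S" unfolding M0_def using S by (simp add: space_restrict_space2)
  define L where "L = restrict_space lborel {a..<b}"
  have spL: "space L = {a..<b}" by (simp add: L_def space_restrict_space)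
  \<comment> \<open>The measurable sets of the delta measure are generated by half-open intervals of
    \<open>T\<close>, so that Borel sets restricted to \<open>S\<close> are among them has to be
    derived from the cuts.\<close>
  have idm: "(\<lambda>x. x) \<in> borel_measurable M0"
  proof (rule borel_measurableI_less)
    fix y
    obtain t where t: "t \<in> T" "a \<le> t" "t \<le> b" "\<forall>s\<in>T \<inter> {a..<b}. s < y \<longleftrightarrow> s < t"
        "\<forall>u\<in>{a..<b}. ts_floor T u < y \<longleftrightarrow> u < t"
      using lessThan_cut[OF cl a b ab, of y] by blast
    have "{x \<in> space M0. x < y} = T \<inter> {a..<t}" using t by (auto simp: sp0 S_def)
    then show "{x \<in> space M0. x < y} \<in> sets M0"
      unfolding M0_def using int[OF a t(1,2)] S t
      by (subst sets_restrict_space_iff) (auto simp: S_def)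
  qed
  have flm: "ts_floor T \<in> borel_measurable L"
  proof (rule borel_measurableI_less)
    fix y
    obtain t where t: "t \<in> T" "a \<le> t" "t \<le> b" "\<forall>s\<in>T \<inter> {a..<b}. s < y \<longleftrightarrow> s < t"
        "\<forall>u\<in>{a..<b}. ts_floor T u < y \<longleftrightarrow> u < t"
      using lessThan_cut[OF cl a b ab, of y] by blast
    have "{x \<in> space L. ts_floor T x < y} = {a..<t}" using t by (auto simp: spL)
    then show "{x \<in> space L. ts_floor T x < y} \<in> sets L"
      unfolding L_def using t by (subst sets_restrict_space_iff) auto
  qed
  have "distr M0 borel (\<lambda>x. x) = distr L borel (ts_floor T)"
  proof (rule measure_eqI_generator_eq[where \<Omega> = UNIV and E = "range lessThan"
        and A = "\<lambda>n. {..<real n}"])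
    show "Int_stable (range (lessThan :: real \<Rightarrow> _))"
    proof -
      have "{..<p} \<inter> {..<q} = {..<min p q}" for p q :: real by auto
      then show ?thesis by (auto simp: Int_stable_def)
    qed
    show eq: "emeasure (distr M0 borel (\<lambda>x. x)) X = emeasure (distr L borel (ts_floor T)) X"
      if X: "X \<in> range lessThan" for X
    proof -
      obtain y where y: "X = {..<y}" using X by auto
      obtain t where t: "t \<in> T" "a \<le> t" "t \<le> b" "\<forall>s\<in>T \<inter> {a..<b}. s < y \<longleftrightarrow> s < t"
        "\<forall>u\<in>{a..<b}. ts_floor T u < y \<longleftrightarrow> u < t"
      using lessThan_cut[OF cl a b ab, of y] by blast
      have 1: "(\<lambda>x. x) -` X \<inter> space M0 = T \<inter> {a..<t}" using t by (auto simp: sp0 S_def y)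
      have 2: "ts_floor T -` X \<inter> space L = {a..<t}" using t by (auto simp: spL y)
      have "emeasure (distr M0 borel (\<lambda>x. x)) X = emeasure M0 (T \<inter> {a..<t})"
        using idm 1 by (simp add: emeasure_distr y)
      also have "\<dots> = emeasure ?D (T \<inter> {a..<t})"
        unfolding M0_def using S t by (intro emeasure_restrict_space) (auto simp: S_def)
      also have "\<dots> = emeasure lborel {a..<t}"
        using emeasure_delta_measure_interval[OF T a t(1,2)] t by simp
      also have "\<dots> = emeasure L {a..<t}"
        unfolding L_def using t by (intro emeasure_restrict_space[symmetric]) auto
      also have "\<dots> = emeasure (distr L borel (ts_floor T)) X"
        using flm 2 by (simp add: emeasure_distr y)
      finally show ?thesis .
    qed
    show "emeasure (distr M0 borel (\<lambda>x. x)) {..<real i} \<noteq> \<infinity>" for i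
    proof -
      have "emeasure (distr M0 borel (\<lambda>x. x)) {..<real i} = emeasure (distr L borel (ts_floor T)) {..<real i}"
        by (rule eq) auto
      also have "\<dots> \<le> emeasure (distr L borel (ts_floor T)) (space (distr L borel (ts_floor T)))"
        by (rule emeasure_space)
      also have "\<dots> = emeasure L {a..<b}" using flm by (simp add: emeasure_distr spL)
      also have "\<dots> = emeasure lborel {a..<b}"
        unfolding L_def by (intro emeasure_restrict_space) auto
      also have "\<dots> < \<infinity>" using ab by simp
      finally show ?thesis by auto
    qed
    show "(\<Union>n. {..<real n}) = UNIV" using reals_Archimedean2 by blast
  qed (auto simp: borel_Iio)
  then have "integral\<^sup>L (distr M0 borel (\<lambda>x. x)) g = integral\<^sup>L (distr L borel (ts_floor T)) g"
    by simp
  then have "integral\<^sup>L M0 g = integral\<^sup>L L (\<lambda>u. g (ts_floor T u))"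
    using idm flm g by (simp add: integral_distr)
  then show "delta_integral T a b g = (LINT u:{a..<b}|lborel. g (ts_floor T u))"
    using ab S unfolding delta_integral_def set_lebesgue_integral_def M0_def L_def S_def[symmetric]
    by (simp add: integral_restrict_space)
  have "(\<lambda>u. g (ts_floor T u)) \<in> borel_measurable L"
    using flm g by simp
  then show "set_borel_measurable lborel {a..<b} (\<lambda>u. g (ts_floor T u))"
    unfolding L_def set_borel_measurable_def by (subst (asm) borel_measurable_restrict_space_iff) auto
qed

lemma delta_integral_cong:
  assumes "a \<le> b" "\<And>t. t \<in> T \<inter> {a..<b} \<Longrightarrow> g t = g' t"
  shows "delta_integral T a b g = delta_integral T a b g'"
proof -
  have "(\<lambda>t. indicator (T \<inter> {a..<b}) t *\<^sub>R g t) = (\<lambda>t. indicator (T \<inter> {a..<b}) t *\<^sub>R g' t)"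
    using assms(2) by (auto simp: indicator_def)
  then show ?thesis
    using assms(1) by (simp only: delta_integral_def set_lebesgue_integral_def if_True)
qed

text \<open>Boundedness gives Lebesgue integrability, which turns the delta integral into a gauge
  integral comparable with the outcome of \<open>delta_fundamental_theorem\<close>.\<close>

lemma delta_integral_has_integral:
  assumes T: "time_scale T" and a: "a \<in> T" and b: "b \<in> T" and ab: "a \<le> b"
    and g: "g \<in> borel_measurable (restrict_space borel (T \<inter> {a..<b}))"
    and B: "\<And>t. t \<in> T \<inter> {a..<b} \<Longrightarrow> \<bar>g t\<bar> \<le> B"
  shows "((\<lambda>u. g (ts_floor T u)) has_integral delta_integral T a b g) {a..b}"
proof -
  have cl: "closed T" using T by (simp add: time_scale_def)
  \<comment> \<open>Extension by zero produces a Borel function on the whole line, as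
    \<open>delta_integral_eq_lborel\<close> demands.\<close>
  define g' where "g' t = indicator (T \<inter> {a..<b}) t * g t" for t
  have g': "g' \<in> borel_measurable borel"
    using g cl unfolding g'_def[abs_def]
    by (subst (asm) borel_measurable_restrict_space_iff) (auto simp: borel_closed)
  have fl: "ts_floor T u \<in> T \<inter> {a..<b}" if "u \<in> {a..<b}" for u
    using that ts_floor_props[OF cl a, of u] by auto
  note m = delta_integral_eq_lborel[OF T a b ab g']
  have "set_integrable lborel {a..<b} (\<lambda>u. g' (ts_floor T u))"
  proof (rule set_integrable_bound)
    show "set_integrable lborel {a..<b} (\<lambda>u. B)"
      using integrable_real_indicator[of "{a..<b}" lborel] ab by (simp add: set_integrable_def)
    show "AE u in lborel. u \<in> {a..<b} \<longrightarrow> norm (g' (ts_floor T u)) \<le> norm B"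
      using B[OF fl] fl by (force simp: g'_def)
  qed (rule m(1))
  then have "((\<lambda>u. g' (ts_floor T u)) has_integral delta_integral T a b g') {a..<b}"
    using set_borel_integral_eq_integral[of "{a..<b}" "\<lambda>u. g' (ts_floor T u)"] m(2)
    by (simp add: has_integral_iff)
  moreover have "delta_integral T a b g' = delta_integral T a b g"
    by (rule delta_integral_cong[OF ab]) (simp add: g'_def)
  ultimately have "((\<lambda>u. g (ts_floor T u)) has_integral delta_integral T a b g) {a..<b}"
    using fl has_integral_eq[of "{a..<b}" "\<lambda>u. g' (ts_floor T u)" "\<lambda>u. g (ts_floor T u)"]
    by (simp add: g'_def)
  then show ?thesis
  proof (rule has_integral_spike_set_eq[THEN iffD1, rotated 2])
    show "negligible {x \<in> {a..<b} - {a..b}. g (ts_floor T x) \<noteq> 0}"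
      by (rule negligible_subset[of "{}"]) auto
    show "negligible {x \<in> {a..b} - {a..<b}. g (ts_floor T x) \<noteq> 0}"
      by (rule negligible_subset[of "{b}"]) auto
  qed
qed

subsection \<open>Uniqueness of delta derivatives\<close>

text \<open>There are points of \<open>T\<close> arbitrarily near \<open>t\<close> and different
  from its jump point, so one may divide by the distance. The second point \<open>r\<close> excludes
  a one-point \<open>T\<close>, where every number is a derivative; \<open>ts_kappa\<close> excludes
  a left-scattered maximum.\<close>

lemma has_delta_derivative_unique:
  assumes D: "has_delta_derivative T f d t" and D': "has_delta_derivative T f d' t"
    and other: "r \<in> T" "r \<noteq> t"
  shows "d = d'"
proof -
  let ?j = "forward_jump T t"
  have t: "t \<in> T" and kappa: "(\<forall>s\<in>T. s \<le> t) \<Longrightarrow> \<not> backward_jump T t < t"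
    using D by (auto simp: has_delta_derivative_def ts_kappa_def)
  have near: "\<exists>s\<in>T. \<bar>s - t\<bar> < \<eta> \<and> ?j \<noteq> s" if \<eta>: "\<eta> > 0" for \<eta>
  proof (cases "?j = t")
    case False
    then show ?thesis using t \<eta> by (intro bexI[of _ t]) auto
  next
    case True
    show ?thesis
    proof (cases "\<exists>s\<in>T. t < s")
      case True
      then obtain s where "s \<in> T" "t < s" by blast
      then obtain q where "q \<in> T" "t < q" "q < t + \<eta>"
        using right_dense_approx[OF \<open>?j = t\<close> _ _ \<eta>] by blast
      then show ?thesis using \<open>?j = t\<close> by (intro bexI[of _ q]) auto
    next
      case False
      have "r < t" using False other by force
      have "\<not> (\<forall>s\<in>{s\<in>T. s < t}. s \<le> t - \<eta>)"
      proof
        assume "\<forall>s\<in>{s\<in>T. s < t}. s \<le> t - \<eta>"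
        then have "Sup {s\<in>T. s < t} \<le> t - \<eta>"
          using other(1) \<open>r < t\<close> by (intro cSup_least) auto
        moreover have "backward_jump T t = Sup {s\<in>T. s < t}"
          using other(1) \<open>r < t\<close> by (auto simp: backward_jump_def)
        ultimately show False using kappa False \<eta> by (auto simp: not_less)
      qed
      then obtain s where "s \<in> T" "s < t" "t - \<eta> < s" by auto
      then show ?thesis using True by (intro bexI[of _ s]) auto
    qed
  qed
  have "\<bar>d - d'\<bar> \<le> e" if "e > 0" for e
  proof -
    have e2: "e / 2 > 0" using that by simp
    obtain U where U: "open U" "t \<in> U"
        "\<forall>s\<in>U \<inter> T. \<bar>f ?j - f s - d * (?j - s)\<bar> \<le> e / 2 * \<bar>?j - s\<bar>"
      using D e2 unfolding has_delta_derivative_def by blast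
    obtain V where V: "open V" "t \<in> V"
        "\<forall>s\<in>V \<inter> T. \<bar>f ?j - f s - d' * (?j - s)\<bar> \<le> e / 2 * \<bar>?j - s\<bar>"
      using D' e2 unfolding has_delta_derivative_def by blast
    obtain \<eta> where \<eta>: "\<eta> > 0" "ball t \<eta> \<subseteq> U \<inter> V"
      using openE[of "U \<inter> V" t] U V by blast
    obtain s where s: "s \<in> T" "\<bar>s - t\<bar> < \<eta>" "?j \<noteq> s" using near[OF \<eta>(1)] by blast
    have "s \<in> ball t \<eta>" using s by (simp add: dist_real_def abs_minus_commute)
    then have "\<bar>f ?j - f s - d * (?j - s)\<bar> \<le> e / 2 * \<bar>?j - s\<bar>"
        "\<bar>f ?j - f s - d' * (?j - s)\<bar> \<le> e / 2 * \<bar>?j - s\<bar>"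
      using \<eta>(2) U(3) V(3) s(1) by blast+
    moreover have "(d - d') * (?j - s)
        = (f ?j - f s - d' * (?j - s)) - (f ?j - f s - d * (?j - s))"
      by (simp add: algebra_simps)
    ultimately have "\<bar>(d - d') * (?j - s)\<bar> \<le> e * \<bar>?j - s\<bar>" by linarith
    then show ?thesis using s(3) by (simp add: abs_mult)
  qed
  then have "\<bar>d - d'\<bar> \<le> 0" by (metis field_le_epsilon add_0)
  then show ?thesis by simp
qed

lemma has_delta_derivative_delta_deriv:
  assumes "delta_differentiable T f t" "r \<in> T" "r \<noteq> t"
  shows "has_delta_derivative T f (delta_deriv T f t) t"
proof -
  obtain d where d: "has_delta_derivative T f d t"
    using assms(1) by (auto simp: delta_differentiable_def)
  show ?thesis
    unfolding delta_deriv_def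
  proof (rule theI[of _ d])
    show "e = d" if "has_delta_derivative T f e t" for e
      by (rule has_delta_derivative_unique[OF that d assms(2,3)])
  qed (rule d)
qed

lemma has_delta_derivative_imp_on:
  assumes D: "has_delta_derivative X g d t" and j: "forward_jump X t = forward_jump T t"
  shows "delta_deriv_on T X g d t"
  unfolding delta_deriv_on_def
proof (intro allI impI)
  fix e :: real assume "e > 0"
  then obtain U where U: "open U" "t \<in> U" "\<forall>s\<in>U \<inter> X.
      \<bar>g (forward_jump T t) - g s - d * (forward_jump T t - s)\<bar> \<le> e * \<bar>forward_jump T t - s\<bar>"
    using D unfolding has_delta_derivative_def j by blast
  obtain \<delta> where \<delta>: "\<delta> > 0" "ball t \<delta> \<subseteq> U" using openE[OF U(1,2)] by blast
  have "s \<in> U" if "\<bar>s - t\<bar> < \<delta>" for s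
    using that \<delta>(2) by (auto simp: dist_real_def abs_minus_commute subset_iff)
  then show "\<exists>\<delta>>0. \<forall>s\<in>X. \<bar>s - t\<bar> < \<delta> \<longrightarrow>
      \<bar>g (forward_jump T t) - g s - d * (forward_jump T t - s)\<bar> \<le> e * \<bar>forward_jump T t - s\<bar>"
    using U(3) \<delta>(1) by (intro exI[of _ \<delta>]) auto
qed

subsection \<open>The Montgomery identity\<close>

lemma delta_integral_swap: "v < u \<Longrightarrow> delta_integral T u v f = - delta_integral T v u f"
  by (simp add: delta_integral_def)

lemma delta_h_1:
  assumes T: "time_scale T" and "s \<in> T" "t \<in> T"
  shows "delta_h T (Suc 0) t s = t - s"
proof -
  have le: "delta_integral T p q (\<lambda>_. 1) = q - p" if "p \<in> T" "q \<in> T" "p \<le> q" for p q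
  proof -
    have "((\<lambda>u. 1::real) has_integral delta_integral T p q (\<lambda>_. 1)) {p..q}"
      by (rule delta_integral_has_integral[OF T that, where B = 1]) auto
    moreover have "((\<lambda>u. 1::real) has_integral (q - p)) {p..q}"
      using has_integral_const_real[of "1::real" p q] that by simp
    ultimately show ?thesis by (rule has_integral_unique)
  qed
  show ?thesis
    using assms le[of s t] le[of t s] delta_integral_swap[of t s T "\<lambda>_. 1"]
    by (cases "s \<le> t") auto
qed

text \<open>For \<open>t \<le> s\<close> the sign from reversing the limits is absorbed into the
  integrand. Both integrands are then nonnegative, as needed for the absolute value of the
  kernel.\<close>

lemma delta_h_2:
  assumes T: "time_scale T" and s: "s \<in> T" and t: "t \<in> T"
  shows "s \<le> t \<Longrightarrow> ((\<lambda>u. ts_floor T u - s) has_integral delta_h T 2 t s) {s..t}"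
    and "t \<le> s \<Longrightarrow> ((\<lambda>u. s - ts_floor T u) has_integral delta_h T 2 t s) {t..s}"
proof -
  have le: "((\<lambda>u. ts_floor T u - s) has_integral delta_integral T p q (\<lambda>\<tau>. delta_h T (Suc 0) \<tau> s)) {p..q}"
    if pq: "p \<in> T" "q \<in> T" "p \<le> q" for p q
  proof -
    have "delta_integral T p q (\<lambda>\<tau>. delta_h T (Suc 0) \<tau> s) = delta_integral T p q (\<lambda>\<tau>. \<tau> - s)"
      using delta_h_1[OF T s] pq by (intro delta_integral_cong) auto
    moreover have "((\<lambda>u. ts_floor T u - s) has_integral delta_integral T p q (\<lambda>\<tau>. \<tau> - s)) {p..q}"
      by (rule delta_integral_has_integral[OF T pq, where B = "\<bar>p\<bar> + \<bar>q\<bar> + \<bar>s\<bar>"])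
        (auto intro!: measurable_restrict_space1)
    ultimately show ?thesis by simp
  qed
  show *: "((\<lambda>u. ts_floor T u - s) has_integral delta_h T 2 t s) {s..t}" if "s \<le> t"
    using le[OF s t that] by (simp add: numeral_2_eq_2)
  show "((\<lambda>u. s - ts_floor T u) has_integral delta_h T 2 t s) {t..s}" if "t \<le> s"
  proof (cases "s = t")
    case True
    then have "((\<lambda>u. ts_floor T u - s) has_integral 0) {s..t}" by (simp add: has_integral_refl)
    then have "delta_h T 2 t s = 0" using has_integral_unique * True by blast
    then show ?thesis using True by (simp add: has_integral_refl)
  next
    case False
    then have "delta_h T 2 t s = - delta_integral T t s (\<lambda>\<tau>. delta_h T (Suc 0) \<tau> s)"
      using that delta_integral_swap[of t s] by (simp add: numeral_2_eq_2)
    then show ?thesis using has_integral_neg[OF le[OF t s that]] by simp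
  qed
qed

text \<open>The left piece agrees with \<open>\<phi>\<close> only before \<open>t\<close>, where the
  kernel switches; the single point \<open>t\<close> is negligible.\<close>

lemma has_integral_split:
  fixes \<phi> \<phi>1 \<phi>2 :: "real \<Rightarrow> real"
  assumes "a \<le> t" "t \<le> b" "(\<phi>1 has_integral I) {a..t}" "(\<phi>2 has_integral J) {t..b}"
    and "\<And>u. a \<le> u \<Longrightarrow> u < t \<Longrightarrow> \<phi> u = \<phi>1 u" "\<And>u. t \<le> u \<Longrightarrow> u \<le> b \<Longrightarrow> \<phi> u = \<phi>2 u"
  shows "(\<phi> has_integral I + J) {a..b}"
proof (rule has_integral_combine[OF assms(1,2)])
  show "(\<phi> has_integral I) {a..t}"
    by (rule has_integral_spike_finite[of "{t}", OF _ _ assms(3)]) (use assms(5) in auto)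
  show "(\<phi> has_integral J) {t..b}"
    by (rule has_integral_eq[OF _ assms(4)]) (use assms(6) in auto)
qed

section \<open>Integrals of the Montgomery kernel and the identity itself\<close>

context
  fixes T :: "real set" and a b :: real
  assumes T: "time_scale T" and a: "a \<in> T" and b: "b \<in> T" and ab: "a < b"
begin

lemma closed_T: "closed T" using T by (simp add: time_scale_def)

lemma floor_mem: "a \<le> u \<Longrightarrow> u \<le> b \<Longrightarrow> ts_floor T u \<in> T \<inter> {a..b}"
  using ts_floor_props[OF closed_T a, of u] by auto

text \<open>As \<open>t\<close> lies in \<open>T\<close>, rounding \<open>u\<close> down does not
  change on which side of \<open>t\<close> it falls.\<close>

lemma kernel_floor:
  assumes t: "t \<in> T" "a \<le> t" and u: "a \<le> u"
  shows "montgomery_kernel a b (ts_floor T u) t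
    = (if u < t then ts_floor T u - a else ts_floor T u - b)"
  using ts_floor_less_iff[OF closed_T a u t(1)] by (simp add: montgomery_kernel_def)

text \<open>The kernel is nonnegative before \<open>t\<close> and nonpositive from \<open>t\<close>
  on, so only the part over \<open>[t,b]\<close> changes sign.\<close>

lemma kernel_has_integral:
  assumes t: "t \<in> T \<inter> {a..b}"
  shows "((\<lambda>u. montgomery_kernel a b (ts_floor T u) t) has_integral
      delta_h T 2 t a - delta_h T 2 t b) {a..b}"
    and "((\<lambda>u. \<bar>montgomery_kernel a b (ts_floor T u) t\<bar>) has_integral
      delta_h T 2 t a + delta_h T 2 t b) {a..b}"
proof -
  have 1: "((\<lambda>u. ts_floor T u - a) has_integral delta_h T 2 t a) {a..t}"
    and 2: "((\<lambda>u. b - ts_floor T u) has_integral delta_h T 2 t b) {t..b}"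
    using delta_h_2(1)[OF T a, of t] delta_h_2(2)[OF T b, of t] t by auto
  have fl: "a \<le> ts_floor T u" "ts_floor T u \<le> b" if "a \<le> u" "u \<le> b" for u
    using floor_mem[OF that] by auto
  show "((\<lambda>u. \<bar>montgomery_kernel a b (ts_floor T u) t\<bar>) has_integral
      delta_h T 2 t a + delta_h T 2 t b) {a..b}"
    by (rule has_integral_split[OF _ _ 1 2]) (use t kernel_floor[of t] fl in auto)
  have "((\<lambda>u. montgomery_kernel a b (ts_floor T u) t) has_integral
      delta_h T 2 t a + - delta_h T 2 t b) {a..b}"
    by (rule has_integral_split[OF _ _ 1 has_integral_neg[OF 2]])
      (use t kernel_floor[of t] in auto)
  then show "((\<lambda>u. montgomery_kernel a b (ts_floor T u) t) has_integral
      delta_h T 2 t a - delta_h T 2 t b) {a..b}" by simp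
qed

lemma continuous_on_delta_h_2:
  "continuous_on (T \<inter> {a..b}) (\<lambda>t. delta_h T 2 t a + delta_h T 2 t b)"
proof -
  have 1: "(\<lambda>u. ts_floor T u - a) integrable_on {a..b}"
    using delta_h_2(1)[OF T a b] ab by (auto simp: has_integral_iff)
  have 2: "(\<lambda>u. b - ts_floor T u) integrable_on {a..b}"
    using delta_h_2(2)[OF T b a] ab by (auto simp: has_integral_iff)
  have "continuous_on {a..b} (\<lambda>t. integral {a..t} (\<lambda>u. ts_floor T u - a)
      + integral {t..b} (\<lambda>u. b - ts_floor T u))"
    by (intro continuous_on_add indefinite_integral_continuous_1[OF 1]
        indefinite_integral_continuous_1'[OF 2])
  then have "continuous_on (T \<inter> {a..b}) (\<lambda>t. integral {a..t} (\<lambda>u. ts_floor T u - a)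
      + integral {t..b} (\<lambda>u. b - ts_floor T u))"
    by (rule continuous_on_subset) auto
  then show ?thesis
  proof (rule continuous_on_eq)
    fix t assume t: "t \<in> T \<inter> {a..b}"
    show "integral {a..t} (\<lambda>u. ts_floor T u - a) + integral {t..b} (\<lambda>u. b - ts_floor T u)
        = delta_h T 2 t a + delta_h T 2 t b"
      using delta_h_2(1)[OF T a, of t] delta_h_2(2)[OF T b, of t] t
      by (auto simp: has_integral_iff)
  qed
qed

text \<open>Continuity up to \<open>b\<close> is asked of \<open>(s - b) * g s\<close> instead of
  \<open>g\<close>, so that the identity also applies to \<open>f1\<close>, which may jump at
  \<open>b\<close>.\<close>

lemma montgomery_identity:
  assumes D: "\<And>s. s \<in> T \<inter> {a..<b} \<Longrightarrow> delta_deriv_on T (T \<inter> {a..b}) g (g' s) s"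
    and t: "t \<in> T \<inter> {a..b}" and cont: "continuous_on (T \<inter> {a..t}) g"
    and cont_b: "continuous_on (T \<inter> {a..b}) (\<lambda>s. (s - b) * g s)"
  shows "((\<lambda>u. montgomery_kernel a b (ts_floor T u) t * g' (ts_floor T u)
      + g (forward_jump T (ts_floor T u))) has_integral (b - a) * g t) {a..b}"
proof -
  have 1: "((\<lambda>u. g (forward_jump T (ts_floor T u)) + (ts_floor T u - a) * g' (ts_floor T u))
      has_integral (t - a) * g t - (a - a) * g a) {a..t}"
  proof (rule delta_fundamental_theorem[OF closed_T a])
    show "delta_deriv_on T (T \<inter> {a..t}) (\<lambda>s. (s - a) * g s)
        (g (forward_jump T s) + (s - a) * g' s) s" if "s \<in> T" "a \<le> s" "s < t" for s
      by (rule delta_deriv_on_mult_linear, rule delta_deriv_on_subset[OF D]) (use that t in auto)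
  qed (use t cont in \<open>auto intro!: continuous_intros\<close>)
  have 2: "((\<lambda>u. g (forward_jump T (ts_floor T u)) + (ts_floor T u - b) * g' (ts_floor T u))
      has_integral (b - b) * g b - (t - b) * g t) {t..b}"
  proof (rule delta_fundamental_theorem[OF closed_T _ b])
    show "delta_deriv_on T (T \<inter> {t..b}) (\<lambda>s. (s - b) * g s)
        (g (forward_jump T s) + (s - b) * g' s) s" if "s \<in> T" "t \<le> s" "s < b" for s
      by (rule delta_deriv_on_mult_linear, rule delta_deriv_on_subset[OF D]) (use that t in auto)
    show "continuous_on (T \<inter> {t..b}) (\<lambda>s. (s - b) * g s)"
      by (rule continuous_on_subset[OF cont_b]) (use t in auto)
  qed (use t in auto)
  have "((\<lambda>u. montgomery_kernel a b (ts_floor T u) t * g' (ts_floor T u)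
      + g (forward_jump T (ts_floor T u))) has_integral
      ((t - a) * g t - (a - a) * g a) + ((b - b) * g b - (t - b) * g t)) {a..b}"
    by (rule has_integral_split[OF _ _ 1 2]) (use t kernel_floor[of t] in auto)
  then show ?thesis by (simp add: algebra_simps)
qed

lemma measurable_comp_forward_jump:
  assumes "g \<in> borel_measurable (restrict_space borel (T \<inter> {a..b}))"
  shows "(\<lambda>t. g (forward_jump T t)) \<in> borel_measurable (restrict_space borel (T \<inter> {a..<b}))"
proof (rule measurable_compose[OF _ assms])
  have "forward_jump T t \<in> T \<inter> {a..b}" if "t \<in> T \<inter> {a..<b}" for t
    using that forward_jump_mem[OF closed_T b, of t] forward_jump_le[OF b, of t] forward_jump_ge[of t T]
    by auto
  then show "forward_jump T \<in> restrict_space borel (T \<inter> {a..<b}) \<rightarrow>\<^sub>M restrict_space borel (T \<inter> {a..b})"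
    by (intro measurable_restrict_space2 measurable_restrict_space1 borel_measurable_mono
        mono_forward_jump) (auto simp: space_restrict_space)
qed

end

subsection \<open>The Ostrowski inequality\<close>

text \<open>At \<open>b\<close> the factor \<open>t - b\<close> tends to 0 and \<open>g\<close> is
  bounded.\<close>

lemma continuous_on_mult_vanishing:
  fixes g :: "real \<Rightarrow> real"
  assumes cont: "continuous_on (X \<inter> {..<b}) g" and X: "X \<subseteq> {..b}"
    and C: "\<And>t. t \<in> X \<Longrightarrow> \<bar>g t\<bar> \<le> C"
  shows "continuous_on X (\<lambda>t. (t - b) * g t)"
  unfolding continuous_on_eq_continuous_within
proof
  fix t assume t: "t \<in> X"
  show "continuous (at t within X) (\<lambda>t. (t - b) * g t)"
  proof (cases "t < b")
    case True
    have "continuous (at t within X \<inter> {..<b}) g"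
      using cont t True by (auto simp: continuous_on_eq_continuous_within)
    moreover have "at t within X \<inter> {..<b} = at t within X"
      using True by (intro at_within_nhd[of t "{..<b}"]) auto
    ultimately show ?thesis by (auto intro!: continuous_intros)
  next
    case False
    then have "t = b" using t X by auto
    have "((\<lambda>s. (s - b) * g s) \<longlongrightarrow> 0) (at b within X)"
    proof (rule Lim_null_comparison)
      show "\<forall>\<^sub>F s in at b within X. norm ((s - b) * g s) \<le> \<bar>s - b\<bar> * C"
        using C by (auto simp: eventually_at_filter abs_mult intro!: always_eventually mult_left_mono)
      have "((\<lambda>s. \<bar>s - b\<bar> * C) \<longlongrightarrow> \<bar>b - b\<bar> * C) (at b within X)"
        by (intro tendsto_intros)
      then show "((\<lambda>s. \<bar>s - b\<bar> * C) \<longlongrightarrow> 0) (at b within X)" by simp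
    qed
    then show ?thesis by (simp add: \<open>t = b\<close> continuous_within)
  qed
qed

text \<open>An arbitrary bound \<open>M\<close> replaces the supremum, so that suprema with and
  without the point \<open>a\<close> are both instances.\<close>

lemma ostrowski_delta:
  fixes f f1 f2 :: "real \<Rightarrow> real"
  assumes T: "time_scale T" and a: "a \<in> T" and b: "b \<in> T" and ab: "a < b"
    and x: "x \<in> T \<inter> {a..b}"
    and cont: "continuous_on (T \<inter> {a..b}) f"
    and D1: "\<And>t. t \<in> T \<inter> {a..<b} \<Longrightarrow> delta_deriv_on T (T \<inter> {a..b}) f (f1 t) t"
    and D2: "\<And>t. t \<in> T \<inter> {a..<b} \<Longrightarrow> delta_deriv_on T (T \<inter> {a..b}) f1 (f2 t) t"
    and M: "\<And>t. t \<in> T \<inter> {a<..<b} \<Longrightarrow> \<bar>f2 t\<bar> \<le> M"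
    and Ma: "x = a \<Longrightarrow> a < forward_jump T a \<Longrightarrow> \<bar>f2 a\<bar> \<le> M"
  shows "\<bar>f x - delta_integral T a b (\<lambda>s. f1 (forward_jump T s)) / (b - a)\<^sup>2
        * (delta_h T 2 x a - delta_h T 2 x b)
      - 1 / (b - a) * delta_integral T a b (\<lambda>t. f (forward_jump T t))\<bar>
    \<le> M / (b - a)\<^sup>2 * delta_integral T a b
        (\<lambda>t. \<bar>montgomery_kernel a b t x\<bar> * (delta_h T 2 t a + delta_h T 2 t b))"
proof -
  have cl: "closed T" using T by (simp add: time_scale_def)
  let ?K = "montgomery_kernel a b"
  let ?p = "ts_floor T"
  let ?j = "forward_jump T"
  let ?X = "T \<inter> {a..b}"
  define H where "H t = delta_h T 2 t a + delta_h T 2 t b" for t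
  have Xb: "?X \<inter> {..<b} = T \<inter> {a..<b}" by auto
  have Xclosed: "closed ?X" using cl by auto
  have X: "compact ?X" using cl by (auto intro: closed_Int_compact)
  have jX: "?j t \<in> ?X" if "t \<in> T \<inter> {a..<b}" for t
    using that forward_jump_mem[OF cl b, of t] forward_jump_le[OF b, of t] forward_jump_ge[of t T]
    by auto

  have cont1: "continuous_on (T \<inter> {a..<b}) f1"
    unfolding continuous_on_eq_continuous_within
  proof
    fix t assume t: "t \<in> T \<inter> {a..<b}"
    have "continuous (at t within ?X) f1" using D2[OF t] t by (auto intro: delta_deriv_on_continuous)
    then show "continuous (at t within T \<inter> {a..<b}) f1" by (rule continuous_within_subset) auto
  qed
  \<comment> \<open>\<open>M\<close> need not bound \<open>f2\<close> at \<open>a\<close>, so that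
    value is added; \<open>0\<close> makes the bound nonnegative.\<close>
  define B where "B = max 0 (max M \<bar>f2 a\<bar>)"
  have B: "\<bar>f2 t\<bar> \<le> B" if "t \<in> T \<inter> {a..<b}" for t
    using M[of t] that by (cases "t = a") (auto simp: B_def)
  \<comment> \<open>Before \<open>b\<close> the bound comes from integrating \<open>f2\<close> from
    \<open>a\<close>; the value at \<open>b\<close> is listed separately because \<open>f1\<close>
    may jump there.\<close>
  define C where "C = max \<bar>f1 b\<bar> (\<bar>f1 a\<bar> + B * (b - a))"
  have C: "\<bar>f1 t\<bar> \<le> C" if "t \<in> ?X" for t
  proof (cases "t = b")
    case False
    then have t: "t \<in> T" "a \<le> t" "t < b" using that by auto
    have "((\<lambda>u. f2 (?p u)) has_integral f1 t - f1 a) {a..t}"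
    proof (rule delta_fundamental_theorem[OF cl a t(1,2)])
      show "delta_deriv_on T (T \<inter> {a..t}) f1 (f2 s) s" if "s \<in> T" "a \<le> s" "s < t" for s
        by (rule delta_deriv_on_subset[OF D2]) (use that t in auto)
      show "continuous_on (T \<inter> {a..t}) f1"
        by (rule continuous_on_subset[OF cont1]) (use t in auto)
    qed
    then have "norm (f1 t - f1 a) \<le> B * measure lborel {a..t}"
    proof (rule has_integral_bound_real[rotated 2])
      show "norm (f2 (?p u)) \<le> B" if "u \<in> {a..t} - {}" for u
        using B[of "?p u"] ts_floor_props[OF cl a, of u] that t by auto
    qed (auto simp: B_def)
    also have "\<dots> \<le> B * (b - a)"
      using t by (auto simp: B_def intro!: mult_left_mono)
    finally show ?thesis by (auto simp: C_def)
  qed (simp add: C_def)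
  have "bounded (f ` ?X)" "bounded (H ` ?X)"
    using cont continuous_on_delta_h_2[OF T a b ab] X
    unfolding H_def by (blast intro: compact_imp_bounded compact_continuous_image)+
  then obtain Cf CH where Cf: "\<And>t. t \<in> ?X \<Longrightarrow> \<bar>f t\<bar> \<le> Cf" and CH: "\<And>t. t \<in> ?X \<Longrightarrow> \<bar>H t\<bar> \<le> CH"
    unfolding bounded_iff by (metis imageI real_norm_def)

  define I where "I = delta_integral T a b (\<lambda>t. f (?j t))"
  define J where "J = delta_integral T a b (\<lambda>t. f1 (?j t))"
  define Q where "Q = delta_integral T a b (\<lambda>t. \<bar>?K t x\<bar> * H t)"
  define W where "W = delta_h T 2 x a - delta_h T 2 x b"
  have I: "((\<lambda>u. f (?j (?p u))) has_integral I) {a..b}"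
    unfolding I_def
  proof (rule delta_integral_has_integral[OF T a b])
    show "(\<lambda>t. f (?j t)) \<in> borel_measurable (restrict_space borel (T \<inter> {a..<b}))"
      by (rule measurable_comp_forward_jump[OF T a b ab])
        (rule borel_measurable_continuous_on_restrict[OF cont])
  qed (use ab Cf jX in auto)
  have J: "((\<lambda>u. f1 (?j (?p u))) has_integral J) {a..b}"
    unfolding J_def
  proof (rule delta_integral_has_integral[OF T a b])
    \<comment> \<open>\<open>f1\<close> is known to be continuous only before \<open>b\<close>, so
      measurability on \<open>[a,b]\<close> is obtained by adding the point \<open>b\<close>
      separately.\<close>
    have "(\<lambda>t. indicator (T \<inter> {a..<b}) t *\<^sub>R f1 t) \<in> borel_measurable borel"
      using cl by (intro borel_measurable_continuous_on_indicator cont1) (auto simp: borel_closed)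
    then have "(\<lambda>t. indicator (T \<inter> {a..<b}) t *\<^sub>R f1 t + indicator {b} t *\<^sub>R f1 b)
        \<in> borel_measurable borel"
      by (intro borel_measurable_add) auto
    also have "(\<lambda>t. indicator (T \<inter> {a..<b}) t *\<^sub>R f1 t + indicator {b} t *\<^sub>R f1 b)
        = (\<lambda>t. indicator ?X t *\<^sub>R f1 t)"
      using b ab by (auto simp: fun_eq_iff indicator_def)
    finally have "f1 \<in> borel_measurable (restrict_space borel ?X)"
      using Xclosed by (subst borel_measurable_restrict_space_iff) (auto simp: borel_closed)
    then show "(\<lambda>t. f1 (?j t)) \<in> borel_measurable (restrict_space borel (T \<inter> {a..<b}))"
      by (rule measurable_comp_forward_jump[OF T a b ab])
  qed (use ab C jX in auto)
  have Q: "((\<lambda>u. \<bar>?K (?p u) x\<bar> * H (?p u)) has_integral Q) {a..b}"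
    unfolding Q_def
  proof (rule delta_integral_has_integral[OF T a b])
    have "continuous_on (T \<inter> {a..<b}) H"
      unfolding H_def by (rule continuous_on_subset[OF continuous_on_delta_h_2[OF T a b ab]]) auto
    then show "(\<lambda>t. \<bar>?K t x\<bar> * H t) \<in> borel_measurable (restrict_space borel (T \<inter> {a..<b}))"
      unfolding montgomery_kernel_def
      by (intro borel_measurable_times borel_measurable_continuous_on_restrict
          measurable_restrict_space1) measurable
    show "\<bar>\<bar>?K t x\<bar> * H t\<bar> \<le> (b - a) * CH" if "t \<in> T \<inter> {a..<b}" for t
      unfolding abs_mult abs_idempotent using that CH[of t] ab
      by (intro mult_mono) (auto simp: montgomery_kernel_def)
  qed (use ab in auto)

  have R: "((\<lambda>u. ?K (?p u) t * f2 (?p u)) has_integral (b - a) * f1 t - J) {a..b}"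
    if t: "t \<in> T \<inter> {a..<b}" for t
  proof -
    have "((\<lambda>u. ?K (?p u) t * f2 (?p u) + f1 (?j (?p u))) has_integral (b - a) * f1 t) {a..b}"
    proof (rule montgomery_identity[OF T a b ab D2])
      show "continuous_on (T \<inter> {a..t}) f1"
        by (rule continuous_on_subset[OF cont1]) (use t in auto)
      show "continuous_on ?X (\<lambda>s. (s - b) * f1 s)"
        using cont1 C by (intro continuous_on_mult_vanishing) (auto simp: Xb)
    qed (use t in auto)
    from has_integral_diff[OF this J] show ?thesis by simp
  qed
  \<comment> \<open>The absolute kernel integrates to \<open>H t\<close>, whence the bound. The
    premise on \<open>t = a\<close> makes \<open>Ma\<close> available in the one case where
    \<open>f2 a\<close> contributes.\<close>
  have R_le: "\<bar>(b - a) * f1 t - J\<bar> \<le> M * H t"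
    if t: "t \<in> T \<inter> {a..<b}" and ta: "t = a \<Longrightarrow> x = a" for t
  proof -
    \<comment> \<open>At \<open>s = t = a\<close> right-dense the bound on \<open>f2\<close> is not available, but \<open>{a}\<close> is a null set.\<close>
  define N where "N = (if t = a \<and> ?j a = a then {a} else {})"
    have "((\<lambda>u. if u \<in> N then 0 else ?K (?p u) t * f2 (?p u)) has_integral (b - a) * f1 t - J) {a..b}"
      by (rule has_integral_spike_finite[OF _ _ R[OF t], of N]) (auto simp: N_def)
    moreover have "((\<lambda>u. M * (if u \<in> N then 0 else \<bar>?K (?p u) t\<bar>)) has_integral M * H t) {a..b}"
      unfolding H_def using t
      by (intro has_integral_mult_right
          has_integral_spike_finite[OF _ _ kernel_has_integral(2)[OF T a b ab, of t], of N])
        (auto simp: N_def)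
    moreover have "norm (if u \<in> N then 0 else ?K (?p u) t * f2 (?p u))
        \<le> M * (if u \<in> N then 0 else \<bar>?K (?p u) t\<bar>)" if u: "u \<in> {a..b}" for u
    proof (cases "u \<in> N \<or> ?K (?p u) t = 0")
      case False
      have pu: "?p u \<in> ?X" using u floor_mem[OF T a b ab, of u] by auto
      \<comment> \<open>The kernel is \<open>b - b\<close> at its right end. Likewise it is
        \<open>a - a\<close> at \<open>a\<close> unless \<open>t = a\<close>, so a contribution of
        \<open>f2 a\<close> forces \<open>t = a\<close> below.\<close>
      have "?p u \<noteq> b" using False t by (auto simp: montgomery_kernel_def)
      moreover have "\<bar>f2 (?p u)\<bar> \<le> M" if pa: "?p u = a"
      proof -
        have "t = a" using False t pa by (auto simp: montgomery_kernel_def split: if_splits)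
        moreover have "a < ?j a"
        proof (rule ccontr)
          assume "\<not> a < ?j a"
          then have ja: "?j a = a" using forward_jump_ge[of a T] by simp
          then have "a < u" using False u \<open>t = a\<close> by (auto simp: N_def)
          then obtain r where "r \<in> T" "a < r" "r < a + (u - a)"
            using right_dense_approx[OF ja b ab, of "u - a"] by auto
          then show False using ts_floor_props(3)[OF cl, of r u] pa by auto
        qed
        ultimately show ?thesis using Ma ta pa by simp
      qed
      ultimately have "\<bar>f2 (?p u)\<bar> \<le> M" using M[of "?p u"] pu by (cases "?p u = a") auto
      then show ?thesis using False by (auto simp: abs_mult mult.commute intro!: mult_left_mono)
    qed auto
    ultimately show ?thesis
      by (metis (no_types, lifting) has_integral_iff integral_norm_bound_integral real_norm_def)
  qed

  have K: "((\<lambda>u. ?K (?p u) x) has_integral W) {a..b}"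
    unfolding W_def by (rule kernel_has_integral(1)[OF T a b ab x])
  have "((\<lambda>u. ?K (?p u) x * f1 (?p u) + f (?j (?p u))) has_integral (b - a) * f x) {a..b}"
  proof (rule montgomery_identity[OF T a b ab D1 x])
    show "continuous_on (T \<inter> {a..x}) f"
      by (rule continuous_on_subset[OF cont]) (use x in auto)
  qed (auto intro!: continuous_intros cont)
  from has_integral_diff[OF this I]
  have "((\<lambda>u. ?K (?p u) x * f1 (?p u)) has_integral (b - a) * f x - I) {a..b}" by simp
  from has_integral_diff[OF has_integral_mult_right[OF this, of "b - a"]
      has_integral_mult_right[OF K, of J]]
  \<comment> \<open>The factor \<open>(b - a) * f1 - J\<close> is the remainder bounded pointwise by
    \<open>R_le\<close>, so the double integral never has to be formed.\<close>
  have KR: "((\<lambda>u. ?K (?p u) x * ((b - a) * f1 (?p u) - J))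
      has_integral (b - a) * ((b - a) * f x - I) - J * W) {a..b}"
    by (simp add: algebra_simps)
  have bound: "norm (?K (?p u) x * ((b - a) * f1 (?p u) - J)) \<le> M * (\<bar>?K (?p u) x\<bar> * H (?p u))"
    if u: "u \<in> {a..b}" for u
  proof (cases "?K (?p u) x = 0")
    case False
    have pu: "?p u \<in> ?X" using u floor_mem[OF T a b ab, of u] by auto
    moreover have "?p u \<noteq> b" using False x by (auto simp: montgomery_kernel_def)
    \<comment> \<open>For \<open>x > a\<close> the outer kernel vanishes at \<open>a\<close>; this
      is the side condition of \<open>R_le\<close>.\<close>
    moreover have "?p u = a \<Longrightarrow> x = a"
      using False x by (auto simp: montgomery_kernel_def split: if_splits)
    ultimately have "\<bar>(b - a) * f1 (?p u) - J\<bar> \<le> M * H (?p u)" by (intro R_le) auto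
    then have "\<bar>?K (?p u) x\<bar> * \<bar>(b - a) * f1 (?p u) - J\<bar> \<le> \<bar>?K (?p u) x\<bar> * (M * H (?p u))"
      by (rule mult_left_mono) simp
    then show ?thesis by (simp add: abs_mult mult.left_commute)
  qed simp
  note MQ = has_integral_mult_right[OF Q, of M]
  have "\<bar>(b - a) * ((b - a) * f x - I) - J * W\<bar> \<le> M * Q"
    using integral_norm_bound_integral[OF has_integral_integrable[OF KR]
        has_integral_integrable[OF MQ] bound]
    unfolding integral_unique[OF KR] integral_unique[OF MQ] by simp
  then have "\<bar>(b - a) * ((b - a) * f x - I) - J * W\<bar> / (b - a)\<^sup>2 \<le> M * Q / (b - a)\<^sup>2"
    by (rule divide_right_mono) simp
  moreover have "\<bar>(b - a) * ((b - a) * f x - I) - J * W\<bar> / (b - a)\<^sup>2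
      = \<bar>((b - a) * ((b - a) * f x - I) - J * W) / (b - a)\<^sup>2\<bar>"
    by simp
  moreover have "((b - a) * ((b - a) * f x - I) - J * W) / (b - a)\<^sup>2
      = f x - J / (b - a)\<^sup>2 * W - 1 / (b - a) * I"
  proof -
    have "(d * (d * f x - I) - J * W) / d\<^sup>2 = f x - J / d\<^sup>2 * W - 1 / d * I" if "d \<noteq> 0" for d :: real
      using that by (simp add: field_simps power2_eq_square)
    then show ?thesis using ab by simp
  qed
  ultimately show ?thesis
    unfolding I_def J_def Q_def W_def H_def by simp
qed

text \<open>If \<open>x = a\<close> is right-scattered, the point \<open>a\<close> has positive
  delta measure and both kernels equal \<open>a - b\<close> there, so \<open>f2 a\<close> enters and
  the supremum must include \<open>a\<close>. In all other cases the supremum over the open interval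
  suffices.\<close>

theorem corollary19:
  fixes T :: "real set" and f f1 f2 :: "real \<Rightarrow> real" and a b c x :: real
  assumes "time_scale T" and "a \<in> T" and "b \<in> T" and "a < b"
    \<comment> \<open>\<open>f\<close> lives on the time scale interval \<open>[a,c]\<close>; the least choice is \<open>c = \<sigma>(b)\<close>\<close>
    and "c \<in> T" and "forward_jump T b \<le> c"
  defines "f1 \<equiv> delta_deriv (T \<inter> {a..c}) f"
    \<comment> \<open>\<open>f1\<close> is a function on \<open>[a,b]\<close> only\<close>
    and "f2 \<equiv> delta_deriv (T \<inter> {a..b}) f1"
  assumes "\<And>t. t \<in> T \<inter> {a..b} \<Longrightarrow> delta_differentiable (T \<inter> {a..c}) f t"
    and "\<And>t. t \<in> T \<inter> {a..<b} \<Longrightarrow> delta_differentiable (T \<inter> {a..b}) f1 t"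
    and "bdd_above ((\<lambda>t. \<bar>f2 t\<bar>) ` (T \<inter> {a<..<b}))"
    and "x \<in> T \<inter> {a..b}"
  defines "lhs \<equiv> \<bar>f x
      - delta_integral T a b (\<lambda>s. f1 (forward_jump T s)) / (b - a)\<^sup>2
        * (delta_h T 2 x a - delta_h T 2 x b)
      - 1 / (b - a) * delta_integral T a b (\<lambda>t. f (forward_jump T t))\<bar>"
    and "rhs \<equiv> (\<lambda>M. M / (b - a)\<^sup>2 * delta_integral T a b
        (\<lambda>t. \<bar>montgomery_kernel a b t x\<bar> * (delta_h T 2 t a + delta_h T 2 t b)))"
  shows "(x \<noteq> a \<or> forward_jump T a = a \<longrightarrow> lhs \<le> rhs (SUP t \<in> T \<inter> {a<..<b}. \<bar>f2 t\<bar>))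
    \<and> lhs \<le> rhs (SUP t \<in> T \<inter> {a..<b}. \<bar>f2 t\<bar>)"
proof -
  let ?X = "T \<inter> {a..c}"
  have bc: "b \<le> c" using forward_jump_ge[of b T] \<open>forward_jump T b \<le> c\<close> by linarith
  have j: "forward_jump Y t = forward_jump T t"
    if "Y = ?X \<or> Y = T \<inter> {a..b}" "t \<in> T \<inter> {a..<b}" for Y t
    by (rule forward_jump_Int[of Y T b]) (use that bc \<open>b \<in> T\<close> in auto)
  \<comment> \<open>A second point, from which the derivatives chosen by \<open>delta_deriv\<close>
    get their uniqueness.\<close>
  have other: "\<exists>r\<in>T \<inter> {a..b}. r \<noteq> t" for t
    using \<open>a \<in> T\<close> \<open>b \<in> T\<close> \<open>a < b\<close> by (cases "t = a") auto
  have D1: "has_delta_derivative ?X f (f1 t) t" if "t \<in> T \<inter> {a..b}" for t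
    unfolding f1_def using assms(9)[OF that] other[of t] bc
    by (auto intro: has_delta_derivative_delta_deriv)
  have D2: "has_delta_derivative (T \<inter> {a..b}) f1 (f2 t) t" if "t \<in> T \<inter> {a..<b}" for t
    unfolding f2_def using assms(10)[OF that] other[of t]
    by (auto intro: has_delta_derivative_delta_deriv)
  have cont: "continuous_on (T \<inter> {a..b}) f"
    unfolding continuous_on_eq_continuous_within
  proof
    fix t assume t: "t \<in> T \<inter> {a..b}"
    have "continuous (at t within ?X) f"
      using has_delta_derivative_imp_on[OF D1[OF t] refl] t bc
      by (auto intro: delta_deriv_on_continuous)
    then show "continuous (at t within T \<inter> {a..b}) f"
      by (rule continuous_within_subset) (use bc in auto)
  qed
  have D1': "delta_deriv_on T (T \<inter> {a..b}) f (f1 t) t" if "t \<in> T \<inter> {a..<b}" for t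
    by (rule delta_deriv_on_subset[OF has_delta_derivative_imp_on[OF D1 j]]) (use that bc in auto)
  have D2': "delta_deriv_on T (T \<inter> {a..b}) f1 (f2 t) t" if "t \<in> T \<inter> {a..<b}" for t
    by (rule has_delta_derivative_imp_on[OF D2 j]) (use that in auto)
  have le: "lhs \<le> rhs M"
    if "\<And>t. t \<in> T \<inter> {a<..<b} \<Longrightarrow> \<bar>f2 t\<bar> \<le> M"
      "x = a \<Longrightarrow> a < forward_jump T a \<Longrightarrow> \<bar>f2 a\<bar> \<le> M" for M
    unfolding lhs_def rhs_def
    by (rule ostrowski_delta[OF assms(1-4,12) cont D1' D2' that])
  have "T \<inter> {a..<b} = insert a (T \<inter> {a<..<b})" using \<open>a \<in> T\<close> \<open>a < b\<close> by auto
  then have "bdd_above ((\<lambda>t. \<bar>f2 t\<bar>) ` (T \<inter> {a..<b}))" using assms(11) by simp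
  then have "lhs \<le> rhs (SUP t \<in> T \<inter> {a..<b}. \<bar>f2 t\<bar>)"
    using \<open>a \<in> T\<close> \<open>a < b\<close> by (intro le) (auto intro!: cSUP_upper)
  moreover have "lhs \<le> rhs (SUP t \<in> T \<inter> {a<..<b}. \<bar>f2 t\<bar>)" if "x \<noteq> a \<or> forward_jump T a = a"
    using that assms(11) by (intro le) (auto intro!: cSUP_upper)
  ultimately show ?thesis by blast
qed

end
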